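(* Let $\mathscr{C}$ be a closed oligomorphic core clone on an at most countable domain $C$ which satisfies Taylor identities locally, i.e., for every finite set $F\subseteq C$ there is a function in $\mathscr{C}$ satisfying some set of Taylor identities on $F$. Then $\mathscr{C}$ satisfies $pL^2_3$.
   Context: A function clone $\mathscr{C}$ on a set $C$ is a set of operations on $C$ of finite arity $\ge 1$ containing all projections and closed under composition. $\operatorname{Gr}(\mathscr{C})$ is the group of all unary bijections in $\mathscr{C}$ whose inverse is also in $\mathscr{C}$. $\mathscr{C}$ is oligomorphic if $\operatorname{Gr}(\mathscr{C})$ has finitely many orbits in its componentwise action on $C^k$ for every $k\ge 1$. $\mathscr{C}$ is closed if it is topologically closed in the set of all finitary operations on $C$ with the topology of pointwise convergence ($C$ discrete). $\mathscr{C}$ is a core if $\operatorname{Gr}(\mathscr{C})$ is dense (pointwise topology) in the unary functions of $\mathscr{C}$. A set of ($n$-ary, $n\ge 1$) Taylor identities is a set of identities $t(x_{i,1},\ldots,x_{i,n})\approx t(y_{i,1},\ldots,y_{i,n})$, $1\le i\le n$, where $t$ is an $n$-ary function symbol, $x_{i,i}=x$, $y_{i,i}=y$, and $x_{i,j},y_{i,j}\in\{x,y\}$ for all $1\le i,j\le n$. An $n$-ary function satisfies these identities on $F$ if, when assigned to $t$, all the equations hold for all values of $x,y$ in $F$. The set of Taylor identities (including its arity) may depend on $F$. $pL^2_3$ is the pseudo-loop condition $u_1\circ f(r_{1,1},\ldots,r_{1,6})\approx u_2\circ f(r_{2,1},\ldots,r_{2,6})$, where $f$ is a $6$-ary and $u_1,u_2$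 are unary function symbols, and $(r_{1,i},r_{2,i})$, $1\le i\le 6$, enumerates all pairs of distinct elements of $\{1,2,3\}$, regarded as variables. $\mathscr{C}$ satisfies it if $f,u_1,u_2$ can be assigned functions of $\mathscr{C}$ such that the equation holds for all values of the variables in $C$. *)

theory Defs
  imports "HOL-Analysis.Analysis"
begin

definition tuples :: "'a set \<Rightarrow> nat \<Rightarrow> 'a list set" where
  "tuples C n = {xs. length xs = n \<and> set xs \<subseteq> C}"

(* An n-ary operation on C is an extensional function on tuples C n, so that equality of
   operations is equality of HOL functions. A set of finitary operations is a set of pairs
   (arity, operation); the arity is explicit because it cannot always be recovered from an
   extensional function (a constant function with value undefined, or the empty domain). *)

definition operations :: "'a set \<Rightarrow> nat \<Rightarrow> ('a list \<Rightarrow> 'a) set" where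
  "operations C n = tuples C n \<rightarrow>\<^sub>E C"

definition projection :: "'a set \<Rightarrow> nat \<Rightarrow> nat \<Rightarrow> 'a list \<Rightarrow> 'a" where
  "projection C n i = (\<lambda>xs\<in>tuples C n. xs ! i)"

definition compose_op ::
  "'a set \<Rightarrow> nat \<Rightarrow> ('a list \<Rightarrow> 'a) \<Rightarrow> ('a list \<Rightarrow> 'a) list \<Rightarrow> 'a list \<Rightarrow> 'a" where
  "compose_op C n f gs = (\<lambda>xs\<in>tuples C n. f (map (\<lambda>g. g xs) gs))"

definition function_clone :: "'a set \<Rightarrow> (nat \<times> ('a list \<Rightarrow> 'a)) set \<Rightarrow> bool" where
  "function_clone C Cl \<longleftrightarrow>
     Cl \<subseteq> Sigma {1..} (operations C) \<and>
     (\<forall>n i. i < n \<longrightarrow> (n, projection C n i) \<in> Cl) \<and>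
     (\<forall>m n f gs. (m, f) \<in> Cl \<and> n \<ge> 1 \<and> length gs = m \<and> (\<forall>g\<in>set gs. (n, g) \<in> Cl)
        \<longrightarrow> (n, compose_op C n f gs) \<in> Cl)"

definition unary_part :: "(nat \<times> ('a list \<Rightarrow> 'a)) set \<Rightarrow> ('a list \<Rightarrow> 'a) set" where
  "unary_part Cl = {f. (1, f) \<in> Cl}"

definition Gr :: "'a set \<Rightarrow> (nat \<times> ('a list \<Rightarrow> 'a)) set \<Rightarrow> ('a list \<Rightarrow> 'a) set" where
  "Gr C Cl = {f \<in> unary_part Cl. bij_betw (\<lambda>x. f [x]) C C \<and>
     (\<exists>g \<in> unary_part Cl. \<forall>x\<in>C. g [f [x]] = x \<and> f [g [x]] = x)}"

definition orbit_of :: "('a list \<Rightarrow> 'a) set \<Rightarrow> 'a list \<Rightarrow> 'a list set" where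
  "orbit_of G xs = {map (\<lambda>x. g [x]) xs | g. g \<in> G}"

definition oligomorphic :: "'a set \<Rightarrow> (nat \<times> ('a list \<Rightarrow> 'a)) set \<Rightarrow> bool" where
  "oligomorphic C Cl \<longleftrightarrow> (\<forall>k\<ge>1. finite (orbit_of (Gr C Cl) ` tuples C k))"

definition pointwise_topology :: "'a set \<Rightarrow> nat \<Rightarrow> ('a list \<Rightarrow> 'a) topology" where
  "pointwise_topology C n = product_topology (\<lambda>_. discrete_topology C) (tuples C n)"

definition finitary_topology :: "'a set \<Rightarrow> (nat \<times> ('a list \<Rightarrow> 'a)) topology" where
  "finitary_topology C = sum_topology (pointwise_topology C) {1..}"

lemma topspace_finitary_topology:
  "topspace (finitary_topology C) = Sigma {1..} (operations C)"
  by (auto simp: finitary_topology_def pointwise_topology_def operations_def)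

definition closed_clone :: "'a set \<Rightarrow> (nat \<times> ('a list \<Rightarrow> 'a)) set \<Rightarrow> bool" where
  "closed_clone C Cl \<longleftrightarrow> closedin (finitary_topology C) Cl"

definition core_clone :: "'a set \<Rightarrow> (nat \<times> ('a list \<Rightarrow> 'a)) set \<Rightarrow> bool" where
  "core_clone C Cl \<longleftrightarrow>
     subtopology (pointwise_topology C 1) (unary_part Cl) closure_of Gr C Cl = unary_part Cl"

datatype xy = X | Y

(* The pair (l, r) stands for the identity t(l) = t(r); positions are counted from 0. *)

definition taylor_identities :: "nat \<Rightarrow> (xy list \<times> xy list) list \<Rightarrow> bool" where
  "taylor_identities n E \<longleftrightarrow> n \<ge> 1 \<and> length E = n \<and>
     (\<forall>i<n. length (fst (E ! i)) = n \<and> length (snd (E ! i)) = n \<and>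
            fst (E ! i) ! i = X \<and> snd (E ! i) ! i = Y)"

definition satisfies_on ::
  "('a list \<Rightarrow> 'a) \<Rightarrow> (xy list \<times> xy list) list \<Rightarrow> 'a set \<Rightarrow> bool" where
  "satisfies_on f E F \<longleftrightarrow>
     (\<forall>\<nu>. range \<nu> \<subseteq> F \<longrightarrow> (\<forall>(l, r) \<in> set E. f (map \<nu> l) = f (map \<nu> r)))"

definition locally_taylor :: "'a set \<Rightarrow> (nat \<times> ('a list \<Rightarrow> 'a)) set \<Rightarrow> bool" where
  "locally_taylor C Cl \<longleftrightarrow>
     (\<forall>F. finite F \<and> F \<subseteq> C \<longrightarrow>
        (\<exists>n E f. taylor_identities n E \<and> (n, f) \<in> Cl \<and> satisfies_on f E F))"

(* The pseudo-loop condition u1(f(a_1,...,a_k)) = u2(f(b_1,...,b_k)) given by the list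
   [(a_1,b_1),...,(a_k,b_k)] of pairs of variables. *)

definition satisfies_pseudo_loop ::
  "'a set \<Rightarrow> (nat \<times> ('a list \<Rightarrow> 'a)) set \<Rightarrow> (nat \<times> nat) list \<Rightarrow> bool" where
  "satisfies_pseudo_loop C Cl es \<longleftrightarrow>
     (\<exists>f u1 u2. (length es, f) \<in> Cl \<and> (1, u1) \<in> Cl \<and> (1, u2) \<in> Cl \<and>
        (\<forall>\<nu>. range \<nu> \<subseteq> C \<longrightarrow>
           u1 [f (map (\<lambda>e. \<nu> (fst e)) es)] = u2 [f (map (\<lambda>e. \<nu> (snd e)) es)]))"

(* Any other enumeration of these pairs only permutes the arguments of f. *)

definition distinct_pairs3 :: "(nat \<times> nat) list" where
  "distinct_pairs3 = [(1,2), (1,3), (2,1), (2,3), (3,1), (3,2)]"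

lemma distinct_pairs3_enumerates:
  "distinct distinct_pairs3"
  "length distinct_pairs3 = 6"
  "set distinct_pairs3 = {(i, j). i \<in> {1,2,3} \<and> j \<in> {1,2,3} \<and> i \<noteq> j}"
  by (auto simp: distinct_pairs3_def)

definition satisfies_pL23 :: "'a set \<Rightarrow> (nat \<times> ('a list \<Rightarrow> 'a)) set \<Rightarrow> bool" where
  "satisfies_pL23 C Cl \<longleftrightarrow> satisfies_pseudo_loop C Cl distinct_pairs3"

end

theory Submission
  imports Defs
begin

text \<open>
  By compactness it suffices to find, for every finite $F$, a 6-ary $f$ in the clone such that the
  two sides of the condition, restricted to $F$, lie in the same orbit of the group. So consider the
  symmetric relation $E$ on tuples indexed by $F^3$ consisting of all pairs $(f(r_1), f(r_2))$; it is
  invariant under the clone and contains a triangle. Suppose that it has no pseudoloop, i.e. no edge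
  inside an orbit. Among all invariant graphs without pseudoloops in which every edge lies in a
  triangle, take one whose vertices meet the fewest orbits and which then has the most edges. In a
  core, orbits are invariant, so the neighbourhood of an orbit $O$ is invariant and misses $O$; by
  minimality it contains no triangle. This forces two vertices with a common edge in their
  neighbourhoods to be twins. Let $f$ satisfy Taylor identities on the entries of a triangle $T$.
  Modulo twins, the image under $f$ of a power of $T$ is a graph in which every edge lies in exactly
  one triangle, so identifying two words that differ at coordinate $i$ makes $f$ independent of
  that coordinate. Hence $f$ is constant on the power of $T$, and its image contains a loop.
\<close>

section \<open>Pseudoloops in graphs invariant under Taylor operations\<close>

text \<open>
  Operations take infinite sequences of arguments, so that no arities are needed; in the Taylor
  condition only the first $k$ arguments matter, and $l$, $r$ mark the occurrences of $x$ in the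
  two sides of the $i$-th identity.
\<close>

locale taylor_action =
  fixes V :: "'b set" and G :: "('b \<Rightarrow> 'b) set" and Ops :: "((nat \<Rightarrow> 'b) \<Rightarrow> 'b) set"
  assumes G_closed: "g \<in> G \<Longrightarrow> x \<in> V \<Longrightarrow> g x \<in> V"
    and G_id: "\<exists>e\<in>G. \<forall>x\<in>V. e x = x"
    and G_inv: "g \<in> G \<Longrightarrow> \<exists>g'\<in>G. \<forall>x\<in>V. g' (g x) = x"
    and G_comp: "g \<in> G \<Longrightarrow> h \<in> G \<Longrightarrow> \<exists>k\<in>G. \<forall>x\<in>V. k x = g (h x)"
    and G_Ops: "g \<in> G \<Longrightarrow> (\<lambda>\<xi>. g (\<xi> 0)) \<in> Ops"
    and finite_orbits: "finite ((\<lambda>x. (\<lambda>g. g x) ` G) ` V)"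
    and finite_pair_orbits: "finite ((\<lambda>(x, y). (\<lambda>g. (g x, g y)) ` G) ` (V \<times> V))"
    and orbit_invariant:
      "f \<in> Ops \<Longrightarrow> x \<in> V \<Longrightarrow> (\<And>i. \<xi> i \<in> (\<lambda>g. g x) ` G) \<Longrightarrow> f \<xi> \<in> (\<lambda>g. g x) ` G"
    and taylor: "finite T \<Longrightarrow> T \<subseteq> V \<Longrightarrow> \<exists>f\<in>Ops. \<exists>k.
      (\<forall>\<xi> \<eta>. (\<forall>i<k. \<xi> i = \<eta> i) \<longrightarrow> f \<xi> = f \<eta>) \<and>
      (\<forall>i<k. \<exists>l r. l i \<and> \<not> r i \<and>
        (\<forall>a\<in>T. \<forall>b\<in>T. f (\<lambda>j. if l j then a else b) = f (\<lambda>j. if r j then a else b)))"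
begin

section \<open>Orbits and invariant relations\<close>

definition orb :: "'b \<Rightarrow> 'b set" where
  "orb x = (\<lambda>g. g x) ` G"

definition pair_orb :: "'b \<times> 'b \<Rightarrow> ('b \<times> 'b) set" where
  "pair_orb p = (\<lambda>g. (g (fst p), g (snd p))) ` G"

definition invariant :: "('b \<times> 'b) set \<Rightarrow> bool" where
  "invariant E \<longleftrightarrow> (\<forall>f\<in>Ops. \<forall>\<xi> \<eta>. (\<forall>i. (\<xi> i, \<eta> i) \<in> E) \<longrightarrow> (f \<xi>, f \<eta>) \<in> E)"

definition good :: "('b \<times> 'b) set \<Rightarrow> bool" where
  "good E \<longleftrightarrow> E \<noteq> {} \<and> E \<subseteq> V \<times> V \<and> sym E \<and> invariant E \<and>
     (\<forall>(x, y)\<in>E. \<exists>z. (x, z) \<in> E \<and> (y, z) \<in> E) \<and> (\<forall>(x, y)\<in>E. y \<notin> orb x)"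

lemma goodD:
  assumes "good E"
  shows "E \<noteq> {}" "E \<subseteq> V \<times> V" "sym E" "invariant E"
    and "(x, y) \<in> E \<Longrightarrow> \<exists>z. (x, z) \<in> E \<and> (y, z) \<in> E" "(x, y) \<in> E \<Longrightarrow> y \<notin> orb x"
  using assms by (auto simp: good_def)

lemma goodI:
  assumes "E \<noteq> {}" "E \<subseteq> V \<times> V" "sym E" "invariant E"
    and "\<And>x y. (x, y) \<in> E \<Longrightarrow> \<exists>z. (x, z) \<in> E \<and> (y, z) \<in> E"
    and "\<And>x y. (x, y) \<in> E \<Longrightarrow> y \<notin> orb x"
  shows "good E"
  using assms by (auto simp: good_def)

text \<open>The tips of two triangles glued along the edge \<open>(u, v)\<close>; the tips may
  coincide.\<close>

definition diamond :: "('b \<times> 'b) set \<Rightarrow> ('b \<times> 'b) set" where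
  "diamond E = {(x, y). \<exists>u v. (x, u) \<in> E \<and> (x, v) \<in> E \<and> (y, u) \<in> E \<and> (y, v) \<in> E \<and> (u, v) \<in> E}"

lemma orb_refl: "x \<in> V \<Longrightarrow> x \<in> orb x"
  using G_id unfolding orb_def by (metis image_eqI)

lemma orb_sym: "x \<in> V \<Longrightarrow> y \<in> orb x \<Longrightarrow> x \<in> orb y"
  unfolding orb_def using G_inv by (smt (verit, best) image_iff)

lemma orb_trans: "x \<in> V \<Longrightarrow> y \<in> orb x \<Longrightarrow> z \<in> orb y \<Longrightarrow> z \<in> orb x"
  unfolding orb_def using G_comp by (smt (verit, best) image_iff)

lemma orb_subset: "x \<in> V \<Longrightarrow> orb x \<subseteq> V"
  unfolding orb_def using G_closed by blast

lemma orb_eq: "x \<in> V \<Longrightarrow> y \<in> orb x \<Longrightarrow> orb y = orb x"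
  using orb_sym orb_trans orb_subset by blast

lemma finite_orb: "finite (orb ` V)"
  using finite_orbits by (simp add: orb_def[abs_def])

lemma finite_pair_orb: "finite (pair_orb ` (V \<times> V))"
  using finite_pair_orbits by (simp add: pair_orb_def[abs_def] case_prod_unfold)

lemma invariantD:
  "invariant E \<Longrightarrow> f \<in> Ops \<Longrightarrow> (\<And>i. (\<xi> i, \<eta> i) \<in> E) \<Longrightarrow> (f \<xi>, f \<eta>) \<in> E"
  unfolding invariant_def by blast

lemma invariant_G: "invariant E \<Longrightarrow> g \<in> G \<Longrightarrow> (x, y) \<in> E \<Longrightarrow> (g x, g y) \<in> E"
  using invariantD[of E "\<lambda>\<xi>. g (\<xi> 0)" "\<lambda>_. x" "\<lambda>_. y"] G_Ops by blast

lemma invariant_relcomp: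
  assumes "invariant E" "invariant E'"
  shows "invariant (E O E')"
  unfolding invariant_def
proof (intro ballI allI impI)
  fix f and \<xi> \<eta> :: "nat \<Rightarrow> 'b"
  assume f: "f \<in> Ops" and "\<forall>i. (\<xi> i, \<eta> i) \<in> E O E'"
  then have "\<forall>i. \<exists>z. (\<xi> i, z) \<in> E \<and> (z, \<eta> i) \<in> E'"
    by blast
  then obtain Z where "\<And>i. (\<xi> i, Z i) \<in> E" "\<And>i. (Z i, \<eta> i) \<in> E'"
    by metis
  then show "(f \<xi>, f \<eta>) \<in> E O E'"
    using invariantD[OF assms(1) f] invariantD[OF assms(2) f] by blast
qed

lemma invariant_diamond:
  assumes "invariant E"
  shows "invariant (diamond E)"
  unfolding invariant_def
proof (intro ballI allI impI)
  fix f and \<xi> \<eta> :: "nat \<Rightarrow> 'b"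
  assume f: "f \<in> Ops" and "\<forall>i. (\<xi> i, \<eta> i) \<in> diamond E"
  then have "\<forall>i. \<exists>u v. (\<xi> i, u) \<in> E \<and> (\<xi> i, v) \<in> E \<and> (\<eta> i, u) \<in> E \<and> (\<eta> i, v) \<in> E \<and> (u, v) \<in> E"
    unfolding diamond_def by blast
  then obtain U W where "\<And>i. (\<xi> i, U i) \<in> E" "\<And>i. (\<xi> i, W i) \<in> E" "\<And>i. (\<eta> i, U i) \<in> E"
      "\<And>i. (\<eta> i, W i) \<in> E" "\<And>i. (U i, W i) \<in> E"
    by metis
  then have "(f \<xi>, f U) \<in> E" "(f \<xi>, f W) \<in> E" "(f \<eta>, f U) \<in> E" "(f \<eta>, f W) \<in> E" "(f U, f W) \<in> E"
    by (simp_all add: invariantD[OF assms f])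
  then show "(f \<xi>, f \<eta>) \<in> diamond E"
    unfolding diamond_def by blast
qed

text \<open>Choosing a predecessor in the orbit for each argument reduces the claim to the orbit
  itself, which operations preserve. Thus neighbourhoods of orbits may serve as the vertex sets
  \<open>W\<close> of \<open>triangle_edges\<close>.\<close>

lemma invariant_Image_orb:
  assumes "invariant R" "a \<in> V" "f \<in> Ops" "\<And>i. \<xi> i \<in> R `` orb a"
  shows "f \<xi> \<in> R `` orb a"
proof -
  have "\<forall>i. \<exists>z. z \<in> orb a \<and> (z, \<xi> i) \<in> R"
    using assms(4) by blast
  then obtain Z where "\<And>i. Z i \<in> orb a" "\<And>i. (Z i, \<xi> i) \<in> R"
    by metis
  moreover from this have "f Z \<in> orb a"
    using orbit_invariant[OF assms(3,2)] unfolding orb_def by blast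
  ultimately show ?thesis
    using invariantD[OF assms(1,3)] by blast
qed

lemma sym_diamond: "sym E \<Longrightarrow> sym (diamond E)"
  unfolding diamond_def sym_def by blast

lemma diamond_refl: "good E \<Longrightarrow> (x, y) \<in> E \<Longrightarrow> (x, x) \<in> diamond E"
  unfolding good_def diamond_def by blast

section \<open>Triangles inside a vertex set, and minimal graphs\<close>

definition triangle_edges :: "('b \<times> 'b) set \<Rightarrow> 'b set \<Rightarrow> ('b \<times> 'b) set" where
  "triangle_edges E W =
     {(x, y) \<in> E. x \<in> W \<and> y \<in> W \<and> (\<exists>z\<in>W. (x, z) \<in> E \<and> (y, z) \<in> E)}"

text \<open>An operation applied to third vertices of the argument edges gives a third vertex of the
  image edge. The other two edges of a triangle lie in that same triangle, so they survive as
  well.\<close>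

lemma good_triangle_edges:
  assumes "invariant E" "sym E" "E \<subseteq> V \<times> V" "\<And>x y. (x, y) \<in> E \<Longrightarrow> y \<notin> orb x"
    and W: "\<And>f \<xi>. f \<in> Ops \<Longrightarrow> (\<And>i. \<xi> i \<in> W) \<Longrightarrow> f \<xi> \<in> W"
    and t: "x \<in> W" "y \<in> W" "z \<in> W" "(x, y) \<in> E" "(x, z) \<in> E" "(y, z) \<in> E"
  shows "good (triangle_edges E W)"
proof -
  let ?E = "triangle_edges E W"
  have "invariant ?E"
    unfolding invariant_def
  proof (intro ballI allI impI)
    fix f and \<xi> \<eta> :: "nat \<Rightarrow> 'b"
    assume f: "f \<in> Ops" and *: "\<forall>i. (\<xi> i, \<eta> i) \<in> ?E"
    then have "\<forall>i. \<exists>z. z \<in> W \<and> (\<xi> i, z) \<in> E \<and> (\<eta> i, z) \<in> E"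
      unfolding triangle_edges_def by blast
    then obtain Z where "\<And>i. Z i \<in> W" "\<And>i. (\<xi> i, Z i) \<in> E" "\<And>i. (\<eta> i, Z i) \<in> E"
      by metis
    moreover have "\<And>i. \<xi> i \<in> W" "\<And>i. \<eta> i \<in> W" "\<And>i. (\<xi> i, \<eta> i) \<in> E"
      using * unfolding triangle_edges_def by auto
    ultimately show "(f \<xi>, f \<eta>) \<in> ?E"
      using W[OF f] invariantD[OF assms(1) f] unfolding triangle_edges_def by blast
  qed
  moreover have "sym ?E"
    using assms(2) unfolding triangle_edges_def sym_def by blast
  moreover have "(x, y) \<in> ?E"
    using t unfolding triangle_edges_def by blast
  moreover have "\<exists>z. (x, z) \<in> ?E \<and> (y, z) \<in> ?E" if "(x, y) \<in> ?E" for x y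
    using that assms(2) unfolding triangle_edges_def sym_def by blast
  moreover have "?E \<subseteq> E"
    unfolding triangle_edges_def by blast
  ultimately show ?thesis
    using assms(3,4) by (intro goodI) blast+
qed

text \<open>Orbits are counted rather than vertices: \<open>V\<close> may be infinite, but it has
  finitely many orbits.\<close>

definition weight :: "('b \<times> 'b) set \<Rightarrow> nat" where
  "weight E = card (orb ` Domain E)"

lemma weight_triangle_edges:
  assumes "good E" "a \<in> Domain E" "orb a \<inter> W = {}"
  shows "weight (triangle_edges E W) < weight E"
proof -
  let ?E = "triangle_edges E W"
  have V: "Domain E \<subseteq> V"
    using goodD(2)[OF assms(1)] by blast
  have sub: "Domain ?E \<subseteq> Domain E" "Domain ?E \<subseteq> W"
    unfolding triangle_edges_def by blast+
  have "orb a \<notin> orb ` Domain ?E"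
    using sub V assms(3) orb_refl by blast
  then have "orb ` Domain ?E \<subset> orb ` Domain E"
    using sub assms(2) by blast
  moreover have "finite (orb ` Domain E)"
    using finite_subset[OF _ finite_orb] V by blast
  ultimately show ?thesis
    unfolding weight_def by (rule psubset_card_mono[rotated])
qed

definition minimal :: "('b \<times> 'b) set \<Rightarrow> bool" where
  "minimal E \<longleftrightarrow> good E \<and> (\<forall>E'. good E' \<longrightarrow> weight E \<le> weight E')"

text \<open>A triangle inside the image of \<open>orb a\<close> under \<open>R\<close> would span a
  good graph that avoids this orbit and hence has smaller weight.\<close>

lemma minimal_no_triangle:
  assumes "minimal E" "a \<in> Domain E" "orb a \<inter> R `` orb a = {}" "invariant R"
    and "x \<in> R `` orb a" "y \<in> R `` orb a" "z \<in> R `` orb a"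
    and "(x, y) \<in> E" "(x, z) \<in> E" "(y, z) \<in> E"
  shows False
proof -
  have E: "good E"
    using assms(1) by (simp add: minimal_def)
  then have a: "a \<in> V"
    using assms(2) goodD(2) by blast
  have "good (triangle_edges E (R `` orb a))"
    using good_triangle_edges[OF goodD(4)[OF E] goodD(3)[OF E] goodD(2)[OF E] _ _ assms(5-10)]
      goodD(6)[OF E] invariant_Image_orb[OF assms(4) a] by blast
  then show False
    using weight_triangle_edges[OF E assms(2,3)] assms(1) unfolding minimal_def by fastforce
qed

text \<open>A group element moving \<open>c\<close> to \<open>a\<close> moves \<open>b\<close>
  inside its orbit, so \<open>a\<close> is adjacent to that orbit. With \<open>u\<close> and
  \<open>v\<close>, neighbours shared by \<open>a\<close> and \<open>b\<close>, it forms a triangle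
  in the neighbourhood of \<open>orb b\<close>, which is disjoint from \<open>orb b\<close>.\<close>

lemma minimal_diamond_edge:
  assumes "minimal E" "(a, b) \<in> diamond E" "(b, c) \<in> E" "c \<in> orb a"
  shows False
proof -
  have E: "good E"
    using assms(1) by (simp add: minimal_def)
  note V = goodD(2)[OF E] and inv = goodD(4)[OF E]
  obtain u v where uv: "(a, u) \<in> E" "(a, v) \<in> E" "(b, u) \<in> E" "(b, v) \<in> E" "(u, v) \<in> E"
    using assms(2) unfolding diamond_def by blast
  have ab: "a \<in> V" "b \<in> V"
    using uv V by blast+
  have "a \<in> orb c"
    using orb_sym ab assms(4) by blast
  then obtain g where g: "g \<in> G" "a = g c"
    unfolding orb_def by blast
  then have "(g b, a) \<in> E"
    using invariant_G[OF inv g(1) assms(3)] by simp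
  moreover have "g b \<in> orb b"
    using g(1) unfolding orb_def by blast
  ultimately have "a \<in> E `` orb b"
    by blast
  moreover have "u \<in> E `` orb b" "v \<in> E `` orb b"
    using uv orb_refl[OF ab(2)] by blast+
  moreover have "orb b \<inter> E `` orb b = {}"
    using goodD(6)[OF E] orb_eq[OF ab(2)] by blast
  ultimately show False
    using minimal_no_triangle[OF assms(1) _ _ inv] uv by blast
qed

text \<open>Walking back from \<open>d\<close> over \<open>c\<close> shows that \<open>b\<close> is
  in the image of \<open>orb a\<close> under \<open>diamond E O E\<close>; so are \<open>u\<close>
  and \<open>v\<close>, since \<open>diamond E\<close> is reflexive at \<open>a\<close>. These three
  form a triangle, and \<open>minimal_diamond_edge\<close> keeps the image disjoint from
  \<open>orb a\<close>.\<close>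

lemma minimal_diamond_edge_diamond:
  assumes "minimal E" "(a, b) \<in> diamond E" "(b, c) \<in> E" "(c, d) \<in> diamond E" "d \<in> orb a"
  shows False
proof -
  have E: "good E"
    using assms(1) by (simp add: minimal_def)
  note V = goodD(2)[OF E] and sym = goodD(3)[OF E] and inv = goodD(4)[OF E]
  obtain u v where uv: "(a, u) \<in> E" "(a, v) \<in> E" "(b, u) \<in> E" "(b, v) \<in> E" "(u, v) \<in> E"
    using assms(2) unfolding diamond_def by blast
  have a: "a \<in> V"
    using uv V by blast
  let ?R = "diamond E O E"
  have "u \<in> ?R `` orb a" "v \<in> ?R `` orb a"
    using uv orb_refl[OF a] diamond_refl[OF E] by blast+
  moreover have "(d, b) \<in> ?R"
    using assms(3,4) sym sym_diamond[OF sym] unfolding sym_def by blast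
  then have "b \<in> ?R `` orb a"
    using assms(5) by blast
  moreover have "orb a \<inter> ?R `` orb a = {}"
    using minimal_diamond_edge[OF assms(1)] orb_eq[OF a] by blast
  ultimately show False
    using minimal_no_triangle[OF assms(1) _ _ invariant_relcomp[OF invariant_diamond[OF inv] inv]]
      uv by blast
qed

text \<open>\<open>diamond E\<close> is reflexive on the vertices of \<open>E\<close> and relates
  only these, so the new graph contains \<open>E\<close> and has no new vertices. Pseudoloops are
  excluded by \<open>minimal_diamond_edge_diamond\<close>.\<close>

lemma minimal_diamond_closure:
  assumes "minimal E"
  shows "minimal (diamond E O E O diamond E)" "E \<subseteq> diamond E O E O diamond E"
proof -
  let ?D = "diamond E" and ?E = "diamond E O E O diamond E"
  have E: "good E"
    using assms(1) by (simp add: minimal_def)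
  note V = goodD(2)[OF E] and sym = goodD(3)[OF E] and inv = goodD(4)[OF E]
  have symD: "sym ?D"
    by (rule sym_diamond[OF sym])
  have DV: "?D \<subseteq> Domain E \<times> Domain E"
    unfolding diamond_def by blast
  have refl: "(x, x) \<in> ?D" if "(x, y) \<in> E \<or> (y, x) \<in> E" for x y
    using that diamond_refl[OF E] sym unfolding sym_def by blast
  show sub: "E \<subseteq> ?E"
  proof
    fix p
    assume "p \<in> E"
    then show "p \<in> ?E"
      using refl by (cases p) blast
  qed
  have "sym ?E"
    using sym symD unfolding sym_def by blast
  moreover have "invariant ?E"
    by (intro invariant_relcomp invariant_diamond inv)
  moreover have "\<exists>z. (x, z) \<in> ?E \<and> (y, z) \<in> ?E" if xy: "(x, y) \<in> ?E" for x y
  proof -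
    obtain b c where bc: "(x, b) \<in> ?D" "(b, c) \<in> E" "(c, y) \<in> ?D"
      using xy by blast
    \<comment> \<open>A third vertex \<open>w\<close> for the middle edge \<open>(b, c)\<close> also
      serves \<open>(x, y)\<close>, with \<open>(w, w)\<close> as the last diamond.\<close>
    obtain w where "(b, w) \<in> E" "(c, w) \<in> E"
      using goodD(5)[OF E bc(2)] by blast
    then show ?thesis
      using refl bc symD unfolding sym_def by blast
  qed
  moreover have "y \<notin> orb x" if "(x, y) \<in> ?E" for x y
    using that minimal_diamond_edge_diamond[OF assms] by blast
  moreover have "?E \<subseteq> V \<times> V"
    using DV V by blast
  ultimately have good: "good ?E"
    using sub goodD(1)[OF E] by (intro goodI) blast+
  have "Domain ?E \<subseteq> Domain E"
    using DV by blast
  then have "weight ?E \<le> weight E"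
    unfolding weight_def
    by (intro card_mono finite_subset[OF _ finite_orb] image_mono) (use V in blast)+
  then show "minimal ?E"
    using good assms unfolding minimal_def by fastforce
qed

text \<open>An invariant relation is a union of pair orbits, so a new edge brings a new pair orbit.
  Pair orbits are counted because there may be infinitely many edges.\<close>

lemma pair_orbits_psubset:
  assumes "invariant E" "E \<subset> E'" "E' \<subseteq> V \<times> V"
  shows "card (pair_orb ` E) < card (pair_orb ` E')"
proof -
  obtain x y where xy: "(x, y) \<in> E'" "(x, y) \<notin> E"
    using assms(2) by auto
  obtain e where "e \<in> G" "\<forall>x\<in>V. e x = x"
    using G_id by blast
  then have "(x, y) \<in> pair_orb (x, y)"
    using xy(1) assms(3) unfolding pair_orb_def by (auto intro!: image_eqI[of _ _ e])
  moreover have "pair_orb p \<subseteq> E" if "p \<in> E" for p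
    using that invariant_G[OF assms(1)] unfolding pair_orb_def by (cases p) auto
  ultimately have "pair_orb (x, y) \<notin> pair_orb ` E"
    using xy(2) by blast
  then have "pair_orb ` E \<subset> pair_orb ` E'"
    using assms(2) xy(1) by blast
  moreover have "finite (pair_orb ` E')"
    by (rule finite_subset[OF _ finite_pair_orb]) (use assms(3) in blast)
  ultimately show ?thesis
    by (rule psubset_card_mono[rotated])
qed

text \<open>Among the graphs of minimal weight there is one with the most pair orbits, as their
  number is bounded. To this one \<open>minimal_diamond_closure\<close> cannot add an edge.\<close>

lemma exists_diamond_closed:
  assumes "good E\<^sub>0"
  shows "\<exists>E. good E \<and> diamond E O E O diamond E = E"
proof -
  obtain E\<^sub>1 where "minimal E\<^sub>1"
    using ex_has_least_nat[of good E\<^sub>0 weight] assms unfolding minimal_def by blast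
  moreover have "card (pair_orb ` E) \<le> card (pair_orb ` (V \<times> V))" if "minimal E" for E
    using that unfolding minimal_def good_def
    by (intro card_mono finite_pair_orb) blast
  ultimately have "\<exists>E. minimal E \<and>
      (\<forall>E'. minimal E' \<longrightarrow> card (pair_orb ` E') \<le> card (pair_orb ` E))"
    using ex_has_greatest_nat[of minimal E\<^sub>1 "\<lambda>E. card (pair_orb ` E)"
        "Suc (card (pair_orb ` (V \<times> V)))"] by (simp add: less_Suc_eq_le)
  then obtain E where E: "minimal E"
    and max: "\<And>E'. minimal E' \<Longrightarrow> card (pair_orb ` E') \<le> card (pair_orb ` E)"
    by blast
  have "\<not> E \<subset> diamond E O E O diamond E"
    using pair_orbits_psubset[of E "diamond E O E O diamond E"] max[OF minimal_diamond_closure(1)[OF E]]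
      E minimal_diamond_closure(1)[OF E] unfolding minimal_def good_def by (metis linorder_not_le)
  then show ?thesis
    using E minimal_diamond_closure(2)[OF E] unfolding minimal_def by blast
qed


section \<open>The contradiction in a diamond-closed graph\<close>

lemma diamond_closed_twins:
  assumes "good E" "diamond E O E O diamond E = E" "(v, w) \<in> diamond E" "(v, x) \<in> E"
  shows "(w, x) \<in> E"
proof -
  have "(w, v) \<in> diamond E"
    using assms(3) sym_diamond[OF goodD(3)[OF assms(1)]] unfolding sym_def by blast
  moreover have "(x, x) \<in> diamond E"
    using assms(4) goodD(3)[OF assms(1)] diamond_refl[OF assms(1)] unfolding sym_def by blast
  \<comment> \<open>The path goes from \<open>w\<close> to \<open>v\<close> by a diamond, to
    \<open>x\<close> by an edge, and stays at \<open>x\<close> by reflexivity.\<close>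
  ultimately have "(w, x) \<in> diamond E O E O diamond E"
    using assms(4) by blast
  then show ?thesis
    using assms(2) by simp
qed

text \<open>Up to twins, \<open>f\<close> does not depend on any of its first \<open>k\<close>
  arguments from \<open>T\<close>. Changing them all from \<open>a\<close> to \<open>b\<close> thus
  keeps the value up to twins, although the two values are adjacent.\<close>

lemma diamond_closed_contradiction:
  assumes "good E" "diamond E O E O diamond E = E"
  shows False
proof -
  note V = goodD(2)[OF assms(1)] and sym = goodD(3)[OF assms(1)] and inv = goodD(4)[OF assms(1)]
  have irrefl: "(x, x) \<notin> E" for x
    using goodD(6)[OF assms(1)] orb_refl V by blast
  have symE: "(y, x) \<in> E" if "(x, y) \<in> E" for x y
    using sym that unfolding sym_def by blast
  obtain a b c where abc: "(a, b) \<in> E" "(a, c) \<in> E" "(b, c) \<in> E"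
    using goodD(1,5)[OF assms(1)] by (metis ex_in_conv surj_pair)
  define T where "T = {a, b, c}"
  have ne: "a \<noteq> b" "a \<noteq> c" "b \<noteq> c"
    using abc irrefl by blast+
  have T: "(x, y) \<in> E" if "x \<in> T" "y \<in> T" "x \<noteq> y" for x y
    using that abc symE unfolding T_def by blast
  have "finite T" "T \<subseteq> V"
    using abc V unfolding T_def by auto
  then obtain f k where f: "f \<in> Ops"
    and "(\<forall>\<xi> \<eta>. (\<forall>i<k. \<xi> i = \<eta> i) \<longrightarrow> f \<xi> = f \<eta>) \<and>
      (\<forall>i<k. \<exists>l r. l i \<and> \<not> r i \<and>
        (\<forall>a\<in>T. \<forall>b\<in>T. f (\<lambda>j. if l j then a else b) = f (\<lambda>j. if r j then a else b)))"
    using taylor[of T] by auto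
  then have dep: "\<And>\<xi> \<eta>. (\<forall>i<k. \<xi> i = \<eta> i) \<Longrightarrow> f \<xi> = f \<eta>"
    and id: "\<And>i. i < k \<Longrightarrow> \<exists>l r. l i \<and> \<not> r i \<and>
        (\<forall>a\<in>T. \<forall>b\<in>T. f (\<lambda>j. if l j then a else b) = f (\<lambda>j. if r j then a else b))"
    by simp_all
  \<comment> \<open>Equality in the quotient by twins is handled as a relation, without forming the
    quotient.\<close>
  define twin where "twin x y \<longleftrightarrow> (\<forall>z. (x, z) \<in> E \<longleftrightarrow> (y, z) \<in> E)" for x y
  have twin_trans: "twin x z" if "twin x y" "twin y z" for x y z
    using that unfolding twin_def by blast
  have twin_sym: "twin y x" if "twin x y" for x y
    using that unfolding twin_def by blast
  \<comment> \<open>\<open>T\<close> is a complete graph, so words over \<open>T\<close> that differ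
    at every position are joined coordinatewise, and invariance carries this to their
    values.\<close>
  have hom: "(f p, f q) \<in> E" if "range p \<subseteq> T" "range q \<subseteq> T" "\<And>j. p j \<noteq> q j" for p q
    using that T by (intro invariantD[OF inv f]) blast
  \<comment> \<open>\<open>f s\<close> and \<open>f r\<close> are joined to each other and to both \<open>f p\<close> (a twin of \<open>f q\<close>) and \<open>f t\<close>.\<close>
  have box: "twin (f p) (f t)"
    if p: "range p \<subseteq> T" and q: "range q \<subseteq> T" and t: "range t \<subseteq> T"
      and pq: "twin (f p) (f q)" and agree: "\<And>j. p j = q j \<Longrightarrow> t j = p j" for p q t
  proof -
    \<comment> \<open>\<open>s\<close> and \<open>r\<close> are the two elements of \<open>T\<close>
      other than the entry of \<open>t\<close>, in an order that avoids \<open>p\<close> and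
      \<open>q\<close>. Such an order is missing only where \<open>p\<close> and \<open>q\<close>
      agree and \<open>t\<close> differs from them; this is what \<open>agree\<close>
      excludes.\<close>
    have "\<exists>s r. s \<in> T \<and> r \<in> T \<and> s \<noteq> x \<and> r \<noteq> y \<and> s \<noteq> r \<and> z \<noteq> s \<and> z \<noteq> r"
      if "x \<in> T" "y \<in> T" "z \<in> T" "x = y \<longrightarrow> z = x" for x y z
      using that ne unfolding T_def by auto
    then have "\<forall>j. \<exists>s r. s \<in> T \<and> r \<in> T \<and> s \<noteq> p j \<and> r \<noteq> q j \<and> s \<noteq> r \<and> t j \<noteq> s \<and> t j \<noteq> r"
      using p q t agree by (simp add: image_subset_iff)
    then obtain s r where sr: "\<And>j. s j \<in> T" "\<And>j. r j \<in> T" "\<And>j. s j \<noteq> p j" "\<And>j. r j \<noteq> q j"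
        "\<And>j. s j \<noteq> r j" "\<And>j. t j \<noteq> s j" "\<And>j. t j \<noteq> r j"
      by metis
    have R: "range s \<subseteq> T" "range r \<subseteq> T"
      using sr(1,2) by auto
    have "(f p, f s) \<in> E" "(f q, f r) \<in> E" "(f s, f r) \<in> E" "(f t, f s) \<in> E" "(f t, f r) \<in> E"
      using hom p q t R sr by metis+
    moreover have "(f p, f r) \<in> E"
      using calculation(2) pq unfolding twin_def by blast
    ultimately have "(f p, f t) \<in> diamond E" "(f t, f p) \<in> diamond E"
      unfolding diamond_def by blast+
    then show ?thesis
      using diamond_closed_twins[OF assms] unfolding twin_def by blast
  qed
  \<comment> \<open>\<open>f p'\<close> and \<open>f q'\<close> both complete the edge from \<open>f s\<close> to \<open>f p\<close>, a twin of \<open>f q\<close>, to a triangle.\<close>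
  have third: "twin (f p') (f q')"
    if R: "range p \<subseteq> T" "range q \<subseteq> T" "range p' \<subseteq> T" "range q' \<subseteq> T" "range s \<subseteq> T"
      and pq: "twin (f p) (f q)"
      and ne: "\<And>j. s j \<noteq> p j" "\<And>j. s j \<noteq> q j" "\<And>j. s j \<noteq> p' j" "\<And>j. s j \<noteq> q' j"
        "\<And>j. p j \<noteq> p' j" "\<And>j. q j \<noteq> q' j" for p q p' q' s
  proof -
    have E: "(f p, f s) \<in> E" "(f q, f s) \<in> E" "(f p', f s) \<in> E" "(f q', f s) \<in> E"
        "(f p, f p') \<in> E" "(f q, f q') \<in> E"
      using hom R ne by metis+
    moreover have "(f p, f q') \<in> E"
      using E(6) pq unfolding twin_def by blast
    ultimately have "(f p', f q') \<in> diamond E" "(f q', f p') \<in> diamond E"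
      using symE unfolding diamond_def by blast+
    then show ?thesis
      using diamond_closed_twins[OF assms] unfolding twin_def by blast
  qed
  have line: "twin (f p) (f (p(i := x)))" if i: "i < k" and p: "range p \<subseteq> T" and x: "x \<in> T" for i p x
  proof -
    \<comment> \<open>\<open>Z\<close> collects the words at which, up to twins, \<open>f\<close>
      ignores the letter at position \<open>i\<close>. The identity puts one word into
      \<open>Z\<close>, and \<open>step\<close> spreads membership to all words over
      \<open>T\<close>.\<close>
    define Z where "Z = {p. range p \<subseteq> T \<and> (\<forall>x\<in>T. \<forall>y\<in>T. twin (f (p(i := x))) (f (p(i := y))))}"
    have upd: "range (p(i := x)) \<subseteq> T" if "range p \<subseteq> T" "x \<in> T" for p x
      using that by auto
    obtain l r where lr: "l i" "\<not> r i"
      "\<And>a b. a \<in> T \<Longrightarrow> b \<in> T \<Longrightarrow> f (\<lambda>j. if l j then a else b) = f (\<lambda>j. if r j then a else b)"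
      using id[OF i] by blast
    \<comment> \<open>The two sides of the \<open>i\<close>-th identity; they differ at
      \<open>i\<close>.\<close>
    define p0 where "p0 = (\<lambda>j. if l j then a else b)"
    define q0 where "q0 = (\<lambda>j. if r j then a else b)"
    have R0: "range p0 \<subseteq> T" "range q0 \<subseteq> T"
      unfolding p0_def q0_def T_def by auto
    have "f p0 = f q0"
      unfolding p0_def q0_def by (rule lr(3)) (simp_all add: T_def)
    then have eq0: "twin (f p0) (f q0)"
      unfolding twin_def by simp
    have ne0: "p0 i \<noteq> q0 i"
      using lr(1,2) ne unfolding p0_def q0_def by simp
    \<comment> \<open>Where \<open>p0\<close> and \<open>q0\<close> agree, \<open>p0(i := x)\<close>
      agrees with them, as \<open>i\<close> is not such a position; so \<open>box\<close>
      applies.\<close>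
    have "twin (f p0) (f (p0(i := x)))" if "x \<in> T" for x
      using ne0 by (intro box[OF R0 upd[OF R0(1) that] eq0]) (auto simp: fun_upd_def)
    then have Z0: "p0 \<in> Z"
      using twin_trans twin_sym R0 unfolding Z_def by blast
    have step: "q \<in> Z" if p: "p \<in> Z" and q: "range q \<subseteq> T" and pq: "\<And>j. j \<noteq> i \<Longrightarrow> p j \<noteq> q j" for p q
    proof -
      have Rp: "range p \<subseteq> T"
        using p unfolding Z_def by blast
      have "twin (f (q(i := x))) (f (q(i := y)))" if xy: "x \<in> T" "y \<in> T" for x y
      proof (cases "x = y")
        case True
        then show ?thesis
          unfolding twin_def by simp
      next
        case False
        have "\<exists>z. z \<in> T \<and> z \<noteq> x \<and> z \<noteq> y" if "x \<in> T" "y \<in> T" for x y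
          using that ne unfolding T_def by auto
        then have "\<forall>j. \<exists>z. z \<in> T \<and> z \<noteq> (p(i := y)) j \<and> z \<noteq> (q(i := x)) j"
          using upd[OF Rp xy(2)] upd[OF q xy(1)] by (simp add: image_subset_iff)
        then obtain s where s: "\<And>j. s j \<in> T" "\<And>j. s j \<noteq> (p(i := y)) j" "\<And>j. s j \<noteq> (q(i := x)) j"
          by metis
        have si: "s i \<noteq> x" "s i \<noteq> y"
          using s(2,3)[of i] by simp_all
        have sj: "s j \<noteq> p j" "s j \<noteq> q j" if "j \<noteq> i" for j
          using s(2,3)[of j] that by simp_all
        have tw: "twin (f (p(i := y))) (f (p(i := x)))"
          using p xy unfolding Z_def by blast
        have Rs: "range s \<subseteq> T"
          using s(1) by blast
        \<comment> \<open>The letters at \<open>i\<close> are crossed: \<open>p(i := y)\<close> is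
          paired with \<open>q(i := x)\<close>, and \<open>p(i := x)\<close> with
          \<open>q(i := y)\<close>, so that the words of each pair differ everywhere.\<close>
        show ?thesis
          by (rule third[OF upd[OF Rp xy(2)] upd[OF Rp xy(1)] upd[OF q xy(1)] upd[OF q xy(2)] Rs tw])
            (use s(1) si sj pq False in \<open>auto simp: fun_upd_def\<close>)
      qed
      then show ?thesis
        using q unfolding Z_def by blast
    qed
    \<comment> \<open>\<open>p\<close> and \<open>p0\<close> may share letters, so
      \<open>step\<close> is taken twice, by way of a word \<open>m\<close> that avoids
      both.\<close>
    have "\<exists>z. z \<in> T \<and> z \<noteq> x \<and> z \<noteq> y" if "x \<in> T" "y \<in> T" for x y
      using that ne unfolding T_def by auto
    then have "\<forall>j. \<exists>z. z \<in> T \<and> z \<noteq> p0 j \<and> z \<noteq> p j"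
      using R0(1) p by (simp add: image_subset_iff)
    then obtain m where m: "\<And>j. m j \<in> T" "\<And>j. m j \<noteq> p0 j" "\<And>j. m j \<noteq> p j"
      by metis
    have "m \<in> Z"
      by (rule step[OF Z0]) (use m in \<open>auto simp: eq_commute\<close>)
    then have "p \<in> Z"
      by (rule step) (use m p in auto)
    then have "twin (f (p(i := p i))) (f (p(i := x)))"
      using x p unfolding Z_def by blast
    then show ?thesis
      by simp
  qed
  \<comment> \<open>\<open>w n\<close> turns the constant word \<open>a\<close> into
    \<open>b\<close> one letter at a time. From \<open>n = k\<close> on, \<open>f\<close> cannot
    tell it from the constant word \<open>b\<close>.\<close>
  define w where "w n = (\<lambda>j::nat. if j < n then b else a)" for n :: nat
  have Rw: "range (w n) \<subseteq> T" for n
    unfolding w_def T_def by auto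
  have "twin (f (w 0)) (f (w n))" if "n \<le> k" for n
    using that
  proof (induction n)
    case 0
    then show ?case
      unfolding twin_def by simp
  next
    case (Suc n)
    have "w (Suc n) = (w n)(n := b)"
      unfolding w_def by auto
    then show ?case
      using Suc line[of n "w n" b] Rw twin_trans unfolding T_def by (metis Suc_le_eq insertCI less_or_eq_imp_le)
  qed
  then have "twin (f (w 0)) (f (w k))"
    by simp
  moreover have "f (w k) = f (\<lambda>_. b)"
    by (rule dep) (simp add: w_def)
  moreover have "(f (w 0), f (\<lambda>_. b)) \<in> E"
    by (rule hom) (use ne in \<open>auto simp: w_def T_def\<close>)
  ultimately show False
    using irrefl unfolding twin_def by metis
qed

lemma pseudoloop:
  assumes "invariant E" "sym E" "E \<subseteq> V \<times> V" "(x, y) \<in> E" "(x, z) \<in> E" "(y, z) \<in> E"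
  shows "\<exists>(x, y)\<in>E. y \<in> orb x"
proof (rule ccontr)
  assume "\<not> ?thesis"
  then have *: "\<And>x y. (x, y) \<in> E \<Longrightarrow> y \<notin> orb x"
    by blast
  \<comment> \<open>Edges outside triangles are discarded; the given triangle keeps the rest
    nonempty.\<close>
  have "good (triangle_edges E UNIV)"
    by (rule good_triangle_edges[OF assms(1-3) *, where x = x and y = y and z = z])
      (use assms in auto)
  then show False
    using exists_diamond_closed diamond_closed_contradiction by blast
qed

end

section \<open>Closed oligomorphic core clones\<close>

lemma tuples_1: "xs \<in> tuples C 1 \<longleftrightarrow> (\<exists>x\<in>C. xs = [x])"
  by (auto simp: tuples_def length_Suc_conv)

lemma singleton_tuples: "x \<in> C \<Longrightarrow> [x] \<in> tuples C 1"
  by (simp add: tuples_def)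

lemma finite_tuples: "finite F \<Longrightarrow> finite (tuples F n)"
  using finite_lists_length_eq[of F n] by (simp add: tuples_def conj_commute)

lemma countable_tuples: "countable C \<Longrightarrow> countable (tuples C n)"
  by (rule countable_subset[OF _ countable_lists]) (auto simp: tuples_def)

text \<open>These are basic neighbourhoods of \<open>g\<close>: only the finitely many coordinates
  in \<open>S\<close> are restricted.\<close>

lemma openin_pointwise_topology:
  assumes "finite S" "S \<subseteq> tuples C n" "g \<in> operations C n"
  shows "openin (pointwise_topology C n) {h \<in> operations C n. \<forall>x\<in>S. h x = g x}"
proof -
  have "{h \<in> operations C n. \<forall>x\<in>S. h x = g x} =
      (\<Pi>\<^sub>E x\<in>tuples C n. if x \<in> S then {g x} else C)"
    (is "?L = ?R")
  proof (intro set_eqI iffI)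
    fix h
    assume "h \<in> ?L"
    then show "h \<in> ?R"
      by (auto simp: operations_def PiE_iff)
  next
    fix h
    assume h: "h \<in> ?R"
    have "h x \<in> (if x \<in> S then {g x} else C)" if "x \<in> tuples C n" for x
      using PiE_mem[OF h that] .
    then have "h x = g x" if "x \<in> S" for x
      using that assms(2) by (metis singletonD subsetD)
    moreover have "h \<in> tuples C n \<rightarrow>\<^sub>E C"
      using h assms(3) unfolding operations_def PiE_iff by (metis singletonD)
    ultimately show "h \<in> ?L"
      unfolding operations_def by blast
  qed
  moreover have "{i \<in> tuples C n. (if i \<in> S then {g i} else C) \<noteq> C} \<subseteq> S"
    by auto
  ultimately show ?thesis
    using assms unfolding pointwise_topology_def operations_def
    by (auto simp: openin_PiE_gen PiE_iff intro: finite_subset)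
qed

locale oligomorphic_core =
  fixes C :: "'a set" and Cl :: "(nat \<times> ('a list \<Rightarrow> 'a)) set"
  assumes clone: "function_clone C Cl"
    and closed: "closed_clone C Cl"
    and oligomorphic: "oligomorphic C Cl"
    and core: "core_clone C Cl"
begin

section \<open>Composition in the clone and the group laws\<close>

abbreviation \<G> where "\<G> \<equiv> Gr C Cl"

lemma operation: "(n, f) \<in> Cl \<Longrightarrow> f \<in> operations C n" "(n, f) \<in> Cl \<Longrightarrow> n \<ge> 1"
  using clone unfolding function_clone_def by auto

lemma operation_closed: "(n, f) \<in> Cl \<Longrightarrow> xs \<in> tuples C n \<Longrightarrow> f xs \<in> C"
  using operation(1) unfolding operations_def by blast

lemma projection_in: "i < n \<Longrightarrow> (n, projection C n i) \<in> Cl"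
  using clone unfolding function_clone_def by blast

lemma compose_in:
  assumes "(m, f) \<in> Cl" "n \<ge> 1" "\<And>i. i < m \<Longrightarrow> (n, g i) \<in> Cl"
  shows "\<exists>h. (n, h) \<in> Cl \<and> (\<forall>xs\<in>tuples C n. h xs = f (map (\<lambda>i. g i xs) [0..<m]))"
proof (intro exI conjI)
  show "(n, compose_op C n f (map g [0..<m])) \<in> Cl"
    using clone assms unfolding function_clone_def by (auto simp: image_iff)
qed (simp add: compose_op_def comp_def)

lemma compose_unary:
  assumes "(1, u) \<in> Cl" "(n, f) \<in> Cl"
  shows "\<exists>h. (n, h) \<in> Cl \<and> (\<forall>xs\<in>tuples C n. h xs = u [f xs])"
  using compose_in[OF assms(1) operation(2)[OF assms(2)], of "\<lambda>_. f"] assms(2) by simp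

lemma Gr_in: "\<alpha> \<in> \<G> \<Longrightarrow> (1, \<alpha>) \<in> Cl"
  unfolding Gr_def unary_part_def by blast

lemma unary_closed: "(1, u) \<in> Cl \<Longrightarrow> x \<in> C \<Longrightarrow> u [x] \<in> C"
  using operation_closed[of 1 u "[x]"] tuples_1 by blast

lemma Gr_closed: "\<alpha> \<in> \<G> \<Longrightarrow> x \<in> C \<Longrightarrow> \<alpha> [x] \<in> C"
  using unary_closed Gr_in by blast

lemma GrI:
  assumes "(1, f) \<in> Cl" "(1, g) \<in> Cl" "\<And>x. x \<in> C \<Longrightarrow> g [f [x]] = x" "\<And>x. x \<in> C \<Longrightarrow> f [g [x]] = x"
  shows "f \<in> \<G>"
proof -
  have "bij_betw (\<lambda>x. f [x]) C C"
    using assms unary_closed by (intro bij_betw_byWitness[where f' = "\<lambda>x. g [x]"]) auto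
  then show ?thesis
    using assms unfolding Gr_def unary_part_def by blast
qed

lemma Gr_inverse:
  assumes "\<alpha> \<in> \<G>"
  shows "\<exists>\<beta>\<in>\<G>. (\<forall>x\<in>C. \<beta> [\<alpha> [x]] = x) \<and> (\<forall>x\<in>C. \<alpha> [\<beta> [x]] = x)"
proof -
  obtain \<beta> where "(1, \<beta>) \<in> Cl" "\<forall>x\<in>C. \<beta> [\<alpha> [x]] = x \<and> \<alpha> [\<beta> [x]] = x"
    using assms unfolding Gr_def unary_part_def by blast
  then show ?thesis
    using GrI[of \<beta> \<alpha>] Gr_in[OF assms] by blast
qed

lemma Gr_id: "\<exists>\<epsilon>\<in>\<G>. \<forall>x\<in>C. \<epsilon> [x] = x"
proof -
  have "projection C 1 0 [x] = x" if "x \<in> C" for x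
    using that by (simp add: projection_def tuples_def)
  then show ?thesis
    using GrI[of "projection C 1 0" "projection C 1 0"] projection_in[of 0 1] by auto
qed

lemma Gr_compose:
  assumes "\<alpha> \<in> \<G>" "\<beta> \<in> \<G>"
  shows "\<exists>\<gamma>\<in>\<G>. \<forall>x\<in>C. \<gamma> [x] = \<alpha> [\<beta> [x]]"
proof -
  have comp: "\<exists>h. (1, h) \<in> Cl \<and> (\<forall>x\<in>C. h [x] = \<alpha> [\<beta> [x]])" if "\<alpha> \<in> \<G>" "\<beta> \<in> \<G>" for \<alpha> \<beta>
    using compose_unary[OF Gr_in[OF that(1)] Gr_in[OF that(2)]] singleton_tuples by metis
  obtain \<alpha>' \<beta>' where inv: "\<alpha>' \<in> \<G>" "\<forall>x\<in>C. \<alpha>' [\<alpha> [x]] = x" "\<forall>x\<in>C. \<alpha> [\<alpha>' [x]] = x"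
    "\<beta>' \<in> \<G>" "\<forall>x\<in>C. \<beta>' [\<beta> [x]] = x" "\<forall>x\<in>C. \<beta> [\<beta>' [x]] = x"
    using Gr_inverse assms by metis
  obtain \<gamma> \<gamma>' where \<gamma>: "(1, \<gamma>) \<in> Cl" "\<forall>x\<in>C. \<gamma> [x] = \<alpha> [\<beta> [x]]"
    "(1, \<gamma>') \<in> Cl" "\<forall>x\<in>C. \<gamma>' [x] = \<beta>' [\<alpha>' [x]]"
    using comp[OF assms] comp[OF inv(4,1)] by blast
  have "\<gamma> \<in> \<G>"
  proof (rule GrI[OF \<gamma>(1,3)])
    fix x
    assume x: "x \<in> C"
    show "\<gamma>' [\<gamma> [x]] = x"
      using x \<gamma>(2,4) inv(2,5) Gr_closed[OF assms(1)] Gr_closed[OF assms(2)] by metis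
    show "\<gamma> [\<gamma>' [x]] = x"
      using x \<gamma>(2,4) inv(3,6) Gr_closed[OF inv(1)] Gr_closed[OF inv(4)] by metis
  qed
  then show ?thesis
    using \<gamma>(2) by blast
qed

section \<open>Finite approximation and compactness\<close>

lemma core_approx:
  assumes "(1, u) \<in> Cl" "finite S" "S \<subseteq> C"
  shows "\<exists>\<beta>\<in>\<G>. \<forall>x\<in>S. \<beta> [x] = u [x]"
proof -
  let ?T = "subtopology (pointwise_topology C 1) (unary_part Cl)"
  let ?U = "{h \<in> operations C 1. \<forall>x\<in>(\<lambda>x. [x]) ` S. h x = u x}"
  have u: "u \<in> operations C 1" "u \<in> unary_part Cl"
    using operation(1)[OF assms(1)] assms(1) unfolding unary_part_def by auto
  have "openin (pointwise_topology C 1) ?U"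
    by (rule openin_pointwise_topology) (use assms u in \<open>auto simp: tuples_def\<close>)
  then have "openin ?T (?U \<inter> unary_part Cl)"
    unfolding openin_subtopology by blast
  \<comment> \<open>The core property is density of the group in the unary part; hence the
    neighbourhood of \<open>u\<close> given by its values on \<open>S\<close> meets the
    group.\<close>
  moreover have "u \<in> ?T closure_of \<G>"
    using core u unfolding core_clone_def by blast
  moreover have "u \<in> ?U \<inter> unary_part Cl"
    using u by simp
  ultimately have "\<exists>\<beta>. \<beta> \<in> \<G> \<and> \<beta> \<in> ?U \<inter> unary_part Cl"
    by (simp only: in_closure_of)
  then obtain \<beta> where "\<beta> \<in> \<G>" "\<beta> \<in> ?U"
    by (elim exE conjE IntE)
  then have "\<forall>x\<in>S. \<beta> [x] = u [x]"
    by simp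
  then show ?thesis
    using \<open>\<beta> \<in> \<G>\<close> by blast
qed

text \<open>Otherwise \<open>f\<close> has a basic neighbourhood missing the clone. It restricts
  only finitely many arguments, so a member of the clone agreeing with \<open>f\<close> on these
  would lie in it.\<close>

lemma closed_approx:
  assumes f: "f \<in> operations C n" "n \<ge> 1"
    and approx: "\<And>S. finite S \<Longrightarrow> S \<subseteq> tuples C n \<Longrightarrow> \<exists>g. (n, g) \<in> Cl \<and> (\<forall>x\<in>S. g x = f x)"
  shows "(n, f) \<in> Cl"
proof (rule ccontr)
  assume nf: "(n, f) \<notin> Cl"
  let ?P = "pointwise_topology C n"
  let ?U = "{g \<in> operations C n. (n, g) \<notin> Cl}"
  have top: "topspace ?P = operations C n"
    unfolding pointwise_topology_def operations_def by simp
  have "openin (finitary_topology C) (topspace (finitary_topology C) - Cl)"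
    using closed unfolding closed_clone_def closedin_def by blast
  then have "openin ?P {x. (n, x) \<in> topspace (finitary_topology C) - Cl}"
    using f(2) unfolding finitary_topology_def openin_sum_topology by auto
  moreover have "{x. (n, x) \<in> topspace (finitary_topology C) - Cl} = ?U"
    using f(2) by (auto simp: topspace_finitary_topology)
  ultimately have "openin ?P ?U"
    by simp
  moreover have "f \<in> ?U"
    using nf f(1) by simp
  ultimately have "\<exists>W. finite {i \<in> tuples C n. W i \<noteq> topspace (discrete_topology C)} \<and>
      (\<forall>i\<in>tuples C n. openin (discrete_topology C) (W i)) \<and>
      f \<in> Pi\<^sub>E (tuples C n) W \<and> Pi\<^sub>E (tuples C n) W \<subseteq> ?U"
    unfolding pointwise_topology_def openin_product_topology_alt by (rule bspec)
  then obtain W where W: "finite {i \<in> tuples C n. W i \<noteq> C}" "f \<in> Pi\<^sub>E (tuples C n) W"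
      "Pi\<^sub>E (tuples C n) W \<subseteq> ?U"
    by (elim exE conjE) simp
  obtain g where g: "(n, g) \<in> Cl" "\<forall>x\<in>{i \<in> tuples C n. W i \<noteq> C}. g x = f x"
    using approx[OF W(1)] by blast
  have "g \<in> Pi\<^sub>E (tuples C n) W"
  proof (rule PiE_I)
    fix x
    assume x: "x \<in> tuples C n"
    show "g x \<in> W x"
    proof (cases "W x = C")
      case True
      then show ?thesis
        using operation_closed[OF g(1) x] by simp
    next
      case False
      then show ?thesis
        using g(2) x PiE_mem[OF W(2) x] by simp
    qed
  next
    fix x
    assume "x \<notin> tuples C n"
    then show "g x = undefined"
      using operation(1)[OF g(1)] unfolding operations_def by (rule PiE_arb[rotated])
  qed
  then show False
    using W(3) g(1) by blast
qed

lemma closed_unary_approx: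
  assumes "\<And>x. x \<in> C \<Longrightarrow> u x \<in> C"
    and "\<And>S. finite S \<Longrightarrow> S \<subseteq> C \<Longrightarrow> \<exists>g. (1, g) \<in> Cl \<and> (\<forall>x\<in>S. g [x] = u x)"
  shows "(1, \<lambda>xs\<in>tuples C 1. u (hd xs)) \<in> Cl"
proof (rule closed_approx)
  show "(\<lambda>xs\<in>tuples C 1. u (hd xs)) \<in> operations C 1"
    unfolding operations_def
  proof (rule restrict_PiE_iff[THEN iffD2], rule ballI)
    fix xs
    assume "xs \<in> tuples C 1"
    then obtain x where "x \<in> C" "xs = [x]"
      unfolding tuples_1 by (elim bexE)
    then show "u (hd xs) \<in> C"
      using assms(1) by simp
  qed
next
  fix S
  assume S: "finite S" "S \<subseteq> tuples C 1"
  have sing: "\<exists>x\<in>C. xs = [x]" if "xs \<in> S" for xs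
    using subsetD[OF S(2) that] unfolding tuples_1 .
  have sub: "hd ` S \<subseteq> C"
  proof (rule image_subsetI)
    fix xs
    assume "xs \<in> S"
    then show "hd xs \<in> C"
      using sing by (metis list.sel(1))
  qed
  obtain g where g: "(1, g) \<in> Cl" "\<forall>x\<in>hd ` S. g [x] = u x"
    using assms(2)[OF finite_imageI[OF S(1)] sub] by (elim exE conjE)
  have "g xs = (\<lambda>xs\<in>tuples C 1. u (hd xs)) xs" if xs: "xs \<in> S" for xs
  proof -
    obtain x where x: "xs = [x]"
      using sing[OF xs] by blast
    then have "g [x] = u x"
      using bspec[OF g(2) imageI[OF xs, of hd]] by simp
    then show ?thesis
      using x subsetD[OF S(2) xs] by simp
  qed
  then show "\<exists>g. (1, g) \<in> Cl \<and> (\<forall>x\<in>S. g x = (\<lambda>xs\<in>tuples C 1. u (hd xs)) x)"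
    using g(1) by blast
qed simp

text \<open>A Koenig-type argument: on each initial segment of \<open>T\<close> the value tuples of
  the \<open>h n\<close> fall into finitely many orbits, so infinitely many of them can be moved to
  the same tuple. \<open>T\<close> is arbitrary, as the lemma is applied both to argument tuples and
  to pairs of a truth value and a point.\<close>

lemma compactness:
  fixes h :: "nat \<Rightarrow> 'b \<Rightarrow> 'a"
  assumes "countable T" and "\<forall>n. \<forall>t\<in>T. h n t \<in> C"
  shows "\<exists>H. (\<forall>t\<in>T. H t \<in> C) \<and>
    (\<forall>S N. finite S \<longrightarrow> S \<subseteq> T \<longrightarrow> (\<exists>n\<ge>N. \<exists>\<alpha>\<in>\<G>. \<forall>t\<in>S. \<alpha> [h n t] = H t))"
proof (cases "T = {}")
  case True
  then show ?thesis
    using Gr_id by auto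
next
  case False
  have h: "h n t \<in> C" if "t \<in> T" for n t
    using assms(2) that by blast
  \<comment> \<open>An enumeration of \<open>T\<close>, with repetitions if \<open>T\<close> is
    finite.\<close>
  define t where "t = from_nat_into T"
  have t: "t i \<in> T" for i
    unfolding t_def by (rule from_nat_into[OF False])
  \<comment> \<open>That \<open>A k w\<close> is infinite says that \<open>w\<close> is a viable
    node at depth \<open>k\<close> of the tree of partial limits.\<close>
  define A where "A k w = {n. \<exists>\<alpha>\<in>\<G>. map (\<lambda>i. \<alpha> [h n (t i)]) [0..<k] = w}" for k w
  have "infinite (A 0 [])"
    using Gr_id unfolding A_def by auto
  moreover have "\<exists>w'. infinite (A (Suc k) w') \<and> (\<exists>x. w' = w @ [x])" if inf: "infinite (A k w)" for k w
  proof -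
    define z where "z n = map (\<lambda>i. h n (t i)) [0..<Suc k]" for n
    have "z n \<in> tuples C (Suc k)" for n
      unfolding z_def tuples_def by (simp add: image_subset_iff h t del: upt_Suc)
    then have "(\<lambda>n. orbit_of \<G> (z n)) ` A k w \<subseteq> orbit_of \<G> ` tuples C (Suc k)"
      by blast
    moreover have "finite (orbit_of \<G> ` tuples C (Suc k))"
      using oligomorphic unfolding oligomorphic_def by simp
    ultimately have "finite ((\<lambda>n. orbit_of \<G> (z n)) ` A k w)"
      by (rule finite_subset)
    then obtain n0 where n0: "n0 \<in> A k w"
      and inf': "infinite {n \<in> A k w. orbit_of \<G> (z n) = orbit_of \<G> (z n0)}"
      using pigeonhole_infinite[OF inf] by blast
    obtain \<alpha> where \<alpha>: "\<alpha> \<in> \<G>" "map (\<lambda>i. \<alpha> [h n0 (t i)]) [0..<k] = w"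
      using n0 unfolding A_def by blast
    \<comment> \<open>The new entry is the image of the next value under the group element chosen
      for \<open>n0\<close>. For any other index in the same orbit, the values are first moved to
      those for \<open>n0\<close>.\<close>
    define x where "x = \<alpha> [h n0 (t k)]"
    have "n \<in> A (Suc k) (w @ [x])" if eq: "orbit_of \<G> (z n) = orbit_of \<G> (z n0)" for n
    proof -
      obtain \<epsilon> where "\<epsilon> \<in> \<G>" "\<forall>x\<in>C. \<epsilon> [x] = x"
        using Gr_id by blast
      moreover from this have "map (\<lambda>x. \<epsilon> [x]) (z n0) = z n0"
        using h t unfolding z_def by simp
      ultimately have "z n0 \<in> orbit_of \<G> (z n)"
        unfolding eq unfolding orbit_of_def by (metis (mono_tags, lifting) mem_Collect_eq)
      then obtain \<beta> where \<beta>: "\<beta> \<in> \<G>" "z n0 = map (\<lambda>x. \<beta> [x]) (z n)"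
        unfolding orbit_of_def by blast
      obtain \<gamma> where \<gamma>: "\<gamma> \<in> \<G>" "\<forall>x\<in>C. \<gamma> [x] = \<alpha> [\<beta> [x]]"
        using Gr_compose[OF \<alpha>(1) \<beta>(1)] by blast
      have "h n0 (t i) = \<beta> [h n (t i)]" if "i < Suc k" for i
        using arg_cong[OF \<beta>(2), of "\<lambda>l. l ! i"] that unfolding z_def by (simp del: upt_Suc)
      then have "map (\<lambda>i. \<gamma> [h n (t i)]) [0..<Suc k] = map (\<lambda>i. \<alpha> [h n0 (t i)]) [0..<Suc k]"
        using \<gamma>(2) h t by (simp del: upt_Suc)
      also have "\<dots> = w @ [x]"
        using \<alpha>(2) unfolding x_def by simp
      finally show ?thesis
        using \<gamma>(1) unfolding A_def by blast
    qed
    then have "{n \<in> A k w. orbit_of \<G> (z n) = orbit_of \<G> (z n0)} \<subseteq> A (Suc k) (w @ [x])"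
      by blast
    then have "infinite (A (Suc k) (w @ [x]))"
      using inf' by (rule infinite_super)
    then show ?thesis
      by blast
  qed
  ultimately obtain w where w: "\<And>k. infinite (A k (w k))" "\<And>k. \<exists>x. w (Suc k) = w k @ [x]"
    using dependent_nat_choice[of "\<lambda>k w. infinite (A k w)" "\<lambda>k w w'. \<exists>x. w' = w @ [x]"] by metis
  have len: "length (w k) = k" for k
  proof -
    obtain n where "n \<in> A k (w k)"
      using w(1)[of k] by (metis ex_in_conv finite.emptyI)
    then obtain \<alpha> where "map (\<lambda>i. \<alpha> [h n (t i)]) [0..<k] = w k"
      unfolding A_def by blast
    from arg_cong[OF this, of length] show ?thesis
      by simp
  qed
  have prefix: "w k ! i = w (Suc i) ! i" if "i < k" for i k
    using that
  proof (induction k)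
    case (Suc k)
    then show ?case
      using w(2)[of k] len[of k] by (cases "i = k") (auto simp: nth_append)
  qed simp
  have W: "\<exists>n\<ge>N. \<exists>\<alpha>\<in>\<G>. \<forall>i<k. \<alpha> [h n (t i)] = w (Suc i) ! i" for N k
  proof -
    obtain n where "n \<ge> N" "n \<in> A k (w k)"
      using w(1)[of k] unfolding infinite_nat_iff_unbounded_le by blast
    then obtain \<alpha> where "\<alpha> \<in> \<G>" "map (\<lambda>i. \<alpha> [h n (t i)]) [0..<k] = w k"
      unfolding A_def by blast
    moreover from this have "\<alpha> [h n (t i)] = w (Suc i) ! i" if "i < k" for i
      using that prefix[OF that] by (metis (no_types, lifting) add_0 diff_zero length_upt nth_map nth_upt)
    ultimately show ?thesis
      using \<open>n \<ge> N\<close> by blast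
  qed
  \<comment> \<open>Each entry is read off from the first prefix that contains it; longer prefixes
    do not change it.\<close>
  define H where "H s = w (Suc (to_nat_on T s)) ! to_nat_on T s" for s
  have ts: "t (to_nat_on T s) = s" if "s \<in> T" for s
    using that assms(1) unfolding t_def by simp
  have "\<exists>n\<ge>N. \<exists>\<alpha>\<in>\<G>. \<forall>s\<in>S. \<alpha> [h n s] = H s" if S: "finite S" "S \<subseteq> T" for S N
  proof -
    have "\<forall>s\<in>S. to_nat_on T s < Suc (Max (to_nat_on T ` S))"
      using S(1) by (simp add: less_Suc_eq_le)
    moreover obtain n \<alpha> where "n \<ge> N" "\<alpha> \<in> \<G>"
        "\<forall>i<Suc (Max (to_nat_on T ` S)). \<alpha> [h n (t i)] = w (Suc i) ! i"
      using W by blast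
    ultimately have "\<forall>s\<in>S. \<alpha> [h n s] = H s"
      using S(2) ts unfolding H_def by (metis subsetD)
    then show ?thesis
      using \<open>n \<ge> N\<close> \<open>\<alpha> \<in> \<G>\<close> by blast
  qed
  moreover from this[of "{s}" for s] have "\<forall>s\<in>T. H s \<in> C"
    using h Gr_closed by (metis empty_subsetI finite.emptyI finite_insert insert_subset singletonI)
  ultimately show ?thesis
    by blast
qed

section \<open>The action of the clone on tuples\<close>

definition lift :: "nat \<Rightarrow> ('a list \<Rightarrow> 'a) \<Rightarrow> 'a list \<Rightarrow> 'a list" where
  "lift m \<alpha> xs = map (\<lambda>j. \<alpha> [xs ! j]) [0..<m]"

text \<open>Like \<open>lift\<close>, it runs over the positions \<open>[0..<m]\<close> instead of
  mapping over a list. So \<open>lift m \<alpha> (\<xi> 0)\<close> equals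
  \<open>act m 1 \<alpha> \<xi>\<close> for every \<open>\<xi>\<close>, not only for tuples over
  \<open>C\<close>.\<close>

definition act :: "nat \<Rightarrow> nat \<Rightarrow> ('a list \<Rightarrow> 'a) \<Rightarrow> (nat \<Rightarrow> 'a list) \<Rightarrow> 'a list" where
  "act m n f \<xi> = map (\<lambda>j. f (map (\<lambda>i. \<xi> i ! j) [0..<n])) [0..<m]"

lemma tuples_nth: "xs \<in> tuples C m \<Longrightarrow> j < m \<Longrightarrow> xs ! j \<in> C"
  unfolding tuples_def by force

lemma map_upt_tuples: "(\<And>i. i < n \<Longrightarrow> h i \<in> C) \<Longrightarrow> map h [0..<n] \<in> tuples C n"
  unfolding tuples_def by auto

lemma lift_eq_map: "xs \<in> tuples C m \<Longrightarrow> lift m \<alpha> xs = map (\<lambda>x. \<alpha> [x]) xs"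
  unfolding lift_def tuples_def by (auto intro!: nth_equalityI)

lemma lift_orbit: "xs \<in> tuples C m \<Longrightarrow> (\<lambda>g. g xs) ` lift m ` \<G> = orbit_of \<G> xs"
  unfolding orbit_of_def by (auto simp: lift_eq_map image_iff)

text \<open>Two tuples of length \<open>m\<close> are read as one of length \<open>m + m\<close>, so
  that oligomorphicity at that length bounds the number of pair orbits.\<close>

lemma lift_pair_orbit:
  assumes "xs \<in> tuples C m" "ys \<in> tuples C m"
  shows "(\<lambda>g. (g xs, g ys)) ` lift m ` \<G> =
    (\<lambda>zs. (take m zs, drop m zs)) ` orbit_of \<G> (xs @ ys)"
proof -
  have "length xs = m"
    using assms(1) unfolding tuples_def by blast
  then have "(lift m \<alpha> xs, lift m \<alpha> ys) =
      (\<lambda>zs. (take m zs, drop m zs)) (map (\<lambda>x. \<alpha> [x]) (xs @ ys))" for \<alpha>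
    using assms by (simp add: lift_eq_map)
  then have "(\<lambda>\<alpha>. (lift m \<alpha> xs, lift m \<alpha> ys)) ` \<G> =
      (\<lambda>\<alpha>. (\<lambda>zs. (take m zs, drop m zs)) (map (\<lambda>x. \<alpha> [x]) (xs @ ys))) ` \<G>"
    by (rule image_cong[OF refl])
  moreover have "orbit_of \<G> (xs @ ys) = (\<lambda>\<alpha>. map (\<lambda>x. \<alpha> [x]) (xs @ ys)) ` \<G>"
    unfolding orbit_of_def by blast
  ultimately show ?thesis
    by (simp only: image_image)
qed

lemma finite_pair_orbits:
  assumes "m \<ge> 1"
  shows "finite ((\<lambda>(xs, ys). (\<lambda>g. (g xs, g ys)) ` lift m ` \<G>) ` (tuples C m \<times> tuples C m))"
proof -
  have "finite (orbit_of \<G> ` tuples C (m + m))"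
    using oligomorphic assms unfolding oligomorphic_def by simp
  then have "finite ((`) (\<lambda>zs. (take m zs, drop m zs)) ` orbit_of \<G> ` tuples C (m + m))"
    by (rule finite_imageI)
  moreover have "xs @ ys \<in> tuples C (m + m)" if "xs \<in> tuples C m" "ys \<in> tuples C m" for xs ys
    using that unfolding tuples_def by auto
  ultimately show ?thesis
    by (elim finite_subset[rotated]) (auto simp: lift_pair_orbit intro!: imageI)
qed

text \<open>
  Applying $f$ to points of one orbit amounts to applying a unary function to a representative;
  since the clone is a core, this function agrees with a group element on finitely many points.
\<close>

lemma orbit_preserved:
  assumes f: "(n, f) \<in> Cl" and x: "x \<in> tuples C m"
    and \<xi>: "\<And>i. \<xi> i \<in> (\<lambda>g. g x) ` lift m ` \<G>"
  shows "act m n f \<xi> \<in> (\<lambda>g. g x) ` lift m ` \<G>"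
proof -
  have "\<forall>i. \<exists>\<alpha>. \<alpha> \<in> \<G> \<and> \<xi> i = lift m \<alpha> x"
    using \<xi> by blast
  then obtain \<alpha> where \<alpha>: "\<And>i. \<alpha> i \<in> \<G>" "\<And>i. \<xi> i = lift m (\<alpha> i) x"
    by metis
  obtain u where u: "(1, u) \<in> Cl" "\<forall>xs\<in>tuples C 1. u xs = f (map (\<lambda>i. \<alpha> i xs) [0..<n])"
    using compose_in[OF f, of 1 \<alpha>] Gr_in[OF \<alpha>(1)] by auto
  have "finite (set x)" "set x \<subseteq> C"
    using x unfolding tuples_def by auto
  then obtain \<beta> where \<beta>: "\<beta> \<in> \<G>" "\<forall>y\<in>set x. \<beta> [y] = u [y]"
    using core_approx[OF u(1)] by blast
  have "f (map (\<lambda>i. \<xi> i ! j) [0..<n]) = \<beta> [x ! j]" if j: "j < m" for j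
  proof -
    have "x ! j \<in> set x"
      using x j unfolding tuples_def by simp
    then have "\<beta> [x ! j] = u [x ! j]"
      using \<beta>(2) by blast
    also have "\<dots> = f (map (\<lambda>i. \<alpha> i [x ! j]) [0..<n])"
      using u(2) singleton_tuples[OF tuples_nth[OF x j]] by blast
    also have "(\<lambda>i. \<alpha> i [x ! j]) = (\<lambda>i. \<xi> i ! j)"
      using j by (simp add: \<alpha>(2) lift_def)
    finally show ?thesis
      by simp
  qed
  then have "act m n f \<xi> = lift m \<beta> x"
    unfolding act_def lift_def by simp
  then show ?thesis
    using \<beta>(1) by blast
qed

text \<open>The identities are taken on the set of all entries of the tuples in \<open>T\<close>, so
  they hold in every component.\<close>

lemma act_taylor:
  assumes "locally_taylor C Cl" "finite T" "T \<subseteq> tuples C m"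
  shows "\<exists>f\<in>{act m n f | n f. (n, f) \<in> Cl}. \<exists>k.
      (\<forall>\<xi> \<eta>. (\<forall>i<k. \<xi> i = \<eta> i) \<longrightarrow> f \<xi> = f \<eta>) \<and>
      (\<forall>i<k. \<exists>l r. l i \<and> \<not> r i \<and>
        (\<forall>a\<in>T. \<forall>b\<in>T. f (\<lambda>j. if l j then a else b) = f (\<lambda>j. if r j then a else b)))"
proof -
  let ?F = "\<Union>(set ` T)"
  have "finite ?F" "?F \<subseteq> C"
    using assms(2,3) unfolding tuples_def by auto
  then obtain n E f where E: "taylor_identities n E" and f: "(n, f) \<in> Cl" and sat: "satisfies_on f E ?F"
    using assms(1) unfolding locally_taylor_def by meson
  have "act m n f \<xi> = act m n f \<eta>" if "\<forall>i<n. \<xi> i = \<eta> i" for \<xi> \<eta>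
    unfolding act_def using that by (auto intro!: arg_cong[of _ _ f])
  moreover have "\<exists>l r. l i \<and> \<not> r i \<and> (\<forall>a\<in>T. \<forall>b\<in>T.
      act m n f (\<lambda>j. if l j then a else b) = act m n f (\<lambda>j. if r j then a else b))"
    if i: "i < n" for i
  proof -
    define l where "l = fst (E ! i)"
    define r where "r = snd (E ! i)"
    have lr: "length l = n" "length r = n" "l ! i = X" "r ! i = Y" "(l, r) \<in> set E"
      using E i unfolding taylor_identities_def l_def r_def by auto
    have "act m n f (\<lambda>j. if l ! j = X then a else b) = act m n f (\<lambda>j. if r ! j = X then a else b)"
      if ab: "a \<in> T" "b \<in> T" for a b
    proof -
      have "f (map (\<lambda>j. (if l ! j = X then a else b) ! q) [0..<n]) =
          f (map (\<lambda>j. (if r ! j = X then a else b) ! q) [0..<n])" if q: "q < m" for q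
      proof -
        define \<nu> where "\<nu> v = (if v = X then a ! q else b ! q)" for v
        have word: "map (\<lambda>j. (if w ! j = X then a else b) ! q) [0..<n] = map \<nu> w"
          if "length w = n" for w
          using that unfolding \<nu>_def by (intro nth_equalityI) auto
        have "length a = m" "length b = m"
          using ab assms(3) unfolding tuples_def by auto
        then have "a ! q \<in> set a" "b ! q \<in> set b"
          using q by simp_all
        then have "range \<nu> \<subseteq> ?F"
          using ab unfolding \<nu>_def by auto
        then have "f (map \<nu> l) = f (map \<nu> r)"
          using sat lr(5) unfolding satisfies_on_def by blast
        then show ?thesis
          by (simp only: word lr(1,2))
      qed
      then show ?thesis
        unfolding act_def by simp
    qed
    then show ?thesis
      using lr(3,4) by (intro exI[of _ "\<lambda>j. l ! j = X"] exI[of _ "\<lambda>j. r ! j = X"]) simp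
  qed
  ultimately show ?thesis
    using f by (intro bexI[of _ "act m n f"] exI[of _ n]) blast+
qed

lemma taylor_action_tuples:
  assumes "locally_taylor C Cl" "m \<ge> 1"
  shows "taylor_action (tuples C m) (lift m ` \<G>) {act m n f | n f. (n, f) \<in> Cl}"
proof (unfold_locales, goal_cases)
  case (1 g x)
  then show ?case
    using Gr_closed tuples_nth unfolding lift_def by (auto intro!: map_upt_tuples)
next
  case 2
  obtain \<epsilon> where \<epsilon>: "\<epsilon> \<in> \<G>" "\<forall>x\<in>C. \<epsilon> [x] = x"
    using Gr_id by blast
  have "lift m \<epsilon> xs = xs" if "xs \<in> tuples C m" for xs
    using that \<epsilon>(2) by (simp add: lift_eq_map map_idI tuples_def subset_iff)
  then show ?case
    using \<epsilon>(1) by blast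
next
  case (3 g)
  then obtain \<alpha> \<beta> where \<alpha>: "g = lift m \<alpha>" "\<beta> \<in> \<G>" "\<forall>x\<in>C. \<beta> [\<alpha> [x]] = x"
    using Gr_inverse by blast
  have "lift m \<beta> (g xs) = xs" if "xs \<in> tuples C m" for xs
    using that tuples_nth[OF that] \<alpha>(3) unfolding \<alpha>(1) lift_def
    by (intro nth_equalityI) (auto simp: tuples_def)
  then show ?case
    using \<alpha>(2) by blast
next
  case (4 g h)
  then obtain \<alpha> \<beta> \<gamma> where \<alpha>: "g = lift m \<alpha>" "h = lift m \<beta>" "\<gamma> \<in> \<G>" "\<forall>x\<in>C. \<gamma> [x] = \<alpha> [\<beta> [x]]"
    using Gr_compose by blast
  have "lift m \<gamma> xs = g (h xs)" if "xs \<in> tuples C m" for xs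
    using tuples_nth[OF that] \<alpha>(4) unfolding \<alpha>(1,2) lift_def by simp
  then show ?case
    using \<alpha>(3) by blast
next
  case (5 g)
  then obtain \<alpha> where "g = lift m \<alpha>" "(1, \<alpha>) \<in> Cl"
    using Gr_in by blast
  moreover have "(\<lambda>\<xi>. lift m \<alpha> (\<xi> 0)) = act m 1 \<alpha>"
    by (simp add: fun_eq_iff lift_def act_def)
  ultimately show ?case
    by blast
next
  case 6
  have "(\<lambda>x. (\<lambda>g. g x) ` lift m ` \<G>) ` tuples C m = orbit_of \<G> ` tuples C m"
    by (rule image_cong[OF refl lift_orbit])
  then show ?case
    using oligomorphic assms(2) unfolding oligomorphic_def by simp
next
  case 7
  show ?case
    by (rule finite_pair_orbits[OF assms(2)])
next
  case (8 f x \<xi>)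
  then obtain n f0 where "f = act m n f0" "(n, f0) \<in> Cl"
    by blast
  then show ?case
    using orbit_preserved[of n f0 x m \<xi>] 8(2,3) by simp
next
  case (9 T)
  then show ?case
    by (rule act_taylor[OF assms(1)])
qed

section \<open>The pseudo-loop condition on a finite set\<close>

lemma local_pseudo_loop:
  assumes "locally_taylor C Cl" "finite F" "F \<subseteq> C"
  shows "\<exists>f \<alpha>. (6, f) \<in> Cl \<and> \<alpha> \<in> \<G> \<and> (\<forall>\<nu>. \<nu> ` {1, 2, 3} \<subseteq> F \<longrightarrow>
    \<alpha> [f (map (\<lambda>e. \<nu> (fst e)) distinct_pairs3)] = f (map (\<lambda>e. \<nu> (snd e)) distinct_pairs3))"
proof (cases "F = {}")
  \<comment> \<open>Kept apart because oligomorphicity speaks of tuples of positive length only,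
    which forces \<open>m \<ge> 1\<close> below.\<close>
  case True
  then show ?thesis
    using projection_in[of 0 6] Gr_id by auto
next
  case False
  let ?es = distinct_pairs3
  \<comment> \<open>\<open>L\<close> lists the assignments of the three variables. A row collects
    values under all of them, so a group element moving one row to another works for all assignments
    at once.\<close>
  obtain L where L: "set L = F \<times> F \<times> F"
    using finite_list[of "F \<times> F \<times> F"] assms(2) by auto
  define m where "m = length L"
  have "F \<times> F \<times> F \<noteq> {}"
    using False by simp
  then have "L \<noteq> []"
    using L by force
  then have m: "m \<ge> 1"
    unfolding m_def by (cases L) auto
  \<comment> \<open>Every variable other than \<open>1\<close> and \<open>2\<close> defaults to the
    third component, so no bound on \<open>v\<close> is needed.\<close>
  define val where "val t v = (if v = 1 then fst t else if v = 2 then fst (snd t) else snd (snd t))"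
    for t :: "'a \<times> 'a \<times> 'a" and v :: nat
  have val: "val (L ! j) v \<in> C" if "j < m" for j v
    using nth_mem[of j L] that assms(3) unfolding m_def L val_def by auto
  define args where "args j sel = map (\<lambda>e. val (L ! j) (sel e)) ?es"
    for j :: nat and sel :: "nat \<times> nat \<Rightarrow> nat"
  have args: "args j sel \<in> tuples C 6" if "j < m" for j sel
    using val[OF that] unfolding args_def tuples_def by (auto simp: distinct_pairs3_enumerates)
  define row where "row f sel = map (\<lambda>j. f (args j sel)) [0..<m]"
    for f :: "'a list \<Rightarrow> 'a" and sel :: "nat \<times> nat \<Rightarrow> nat"
  have row: "row f sel \<in> tuples C m" if "(6, f) \<in> Cl" for f sel
    unfolding row_def by (rule map_upt_tuples) (rule operation_closed[OF that args])
  \<comment> \<open>The invariant relation generated by the pairs \<open>(c i, c j)\<close> with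
    distinct \<open>i\<close> and \<open>j\<close> among 1, 2, 3, where \<open>c\<close> is the
    family of rows defined below.\<close>
  define E where "E = {(row f fst, row f snd) | f. (6, f) \<in> Cl}"
  let ?Ops = "{act m n f | n f. (n, f) \<in> Cl}"
  interpret taylor_action "tuples C m" "lift m ` \<G>" ?Ops
    by (rule taylor_action_tuples[OF assms(1) m])
  have inv: "invariant E"
    unfolding invariant_def
  proof (intro ballI allI impI)
    fix g and \<xi> \<eta> :: "nat \<Rightarrow> 'a list"
    assume "g \<in> ?Ops" and "\<forall>i. (\<xi> i, \<eta> i) \<in> E"
    then obtain n g0 where g: "g = act m n g0" "(n, g0) \<in> Cl"
      and "\<forall>i. \<exists>f. (6, f) \<in> Cl \<and> \<xi> i = row f fst \<and> \<eta> i = row f snd"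
      unfolding E_def by blast
    then obtain f where f: "\<And>i. (6, f i) \<in> Cl" "\<And>i. \<xi> i = row (f i) fst" "\<And>i. \<eta> i = row (f i) snd"
      by metis
    obtain h where h: "(6, h) \<in> Cl" "\<forall>xs\<in>tuples C 6. h xs = g0 (map (\<lambda>i. f i xs) [0..<n])"
      using compose_in[OF g(2), of 6 f] f(1) by auto
    have "act m n g0 (\<lambda>i. row (f i) sel) = row h sel" for sel
      unfolding act_def row_def using h(2) args by simp
    moreover have "\<xi> = (\<lambda>i. row (f i) fst)" "\<eta> = (\<lambda>i. row (f i) snd)"
      using f(2,3) by (simp_all add: fun_eq_iff)
    ultimately show "(g \<xi>, g \<eta>) \<in> E"
      using h(1) g(1) unfolding E_def by auto
  qed
  have symE: "(y, x) \<in> E" if xy: "(x, y) \<in> E" for x y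
  proof -
    obtain f where f: "(6, f) \<in> Cl" "x = row f fst" "y = row f snd"
      using xy unfolding E_def by blast
    \<comment> \<open>Each pair is sent to the position of its reversal in
      \<open>distinct_pairs3\<close>, counted from 0; permuting the arguments of \<open>f\<close> in
      this way swaps the two sides.\<close>
    define \<sigma> :: "nat list" where "\<sigma> = [2, 4, 0, 5, 1, 3]"
    have \<sigma>: "\<sigma> ! i < 6" if "i < 6" for i
      using that unfolding \<sigma>_def by (auto simp: less_Suc_eq numeral_eq_Suc)
    obtain h where h: "(6, h) \<in> Cl"
      "\<forall>xs\<in>tuples C 6. h xs = f (map (\<lambda>i. projection C 6 (\<sigma> ! i) xs) [0..<6])"
      using compose_in[OF f(1), of 6 "\<lambda>i. projection C 6 (\<sigma> ! i)"] projection_in[OF \<sigma>] by auto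
    have upt: "[0..<6] = [0, 1, 2, 3, 4, 5::nat]"
      by (simp add: upt_rec)
    have perm: "h (args j sel) = f (map (\<lambda>i. args j sel ! (\<sigma> ! i)) [0, 1, 2, 3, 4, 5])"
      if "j < m" for j sel
      using h(2) args[OF that] unfolding upt by (simp add: projection_def)
    have "map (\<lambda>i. args j fst ! (\<sigma> ! i)) [0, 1, 2, 3, 4, 5] = args j snd"
      "map (\<lambda>i. args j snd ! (\<sigma> ! i)) [0, 1, 2, 3, 4, 5] = args j fst" for j
      unfolding \<sigma>_def args_def distinct_pairs3_def by simp_all
    then have "h (args j fst) = f (args j snd)" "h (args j snd) = f (args j fst)" if "j < m" for j
      by (simp_all only: perm[OF that])
    then have "row h fst = y" "row h snd = x"
      unfolding row_def f(2,3) by simp_all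
    then show ?thesis
      using h(1) unfolding E_def by blast
  qed
  \<comment> \<open>The rows of the three variables; the projections make them a triangle in
    \<open>E\<close>.\<close>
  define c where "c v = map (\<lambda>j. val (L ! j) v) [0..<m]" for v
  have edge: "(c (fst (?es ! i)), c (snd (?es ! i))) \<in> E" if i: "i < 6" for i
  proof -
    have "projection C 6 i (args j sel) = val (L ! j) (sel (?es ! i))" if "j < m" for j sel
      using args[OF that] i unfolding projection_def args_def by (simp add: distinct_pairs3_enumerates)
    then have "row (projection C 6 i) sel = c (sel (?es ! i))" for sel
      unfolding row_def c_def by simp
    then show ?thesis
      using projection_in[OF i] unfolding E_def by (metis (mono_tags, lifting) mem_Collect_eq)
  qed
  have "(c 1, c 2) \<in> E" "(c 1, c 3) \<in> E" "(c 2, c 3) \<in> E"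
    using edge[of 0] edge[of 1] edge[of 3] by (simp_all add: distinct_pairs3_def numeral_eq_Suc)
  moreover have "sym E"
    using symE by (rule symI)
  moreover have "E \<subseteq> tuples C m \<times> tuples C m"
    using row unfolding E_def by blast
  ultimately obtain x y where xy: "(x, y) \<in> E" "y \<in> orb x"
    using pseudoloop[OF inv] by blast
  obtain f where f: "(6, f) \<in> Cl" "x = row f fst" "y = row f snd"
    using xy(1) unfolding E_def by blast
  obtain \<alpha> where \<alpha>: "\<alpha> \<in> \<G>" "y = lift m \<alpha> x"
    using xy(2) unfolding orb_def by blast
  have "\<alpha> [f (map (\<lambda>e. \<nu> (fst e)) ?es)] = f (map (\<lambda>e. \<nu> (snd e)) ?es)"
    if \<nu>: "\<nu> ` {1, 2, 3} \<subseteq> F" for \<nu>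
  proof -
    have "(\<nu> 1, \<nu> 2, \<nu> 3) \<in> set L"
      using \<nu> unfolding L by auto
    then obtain j where j: "j < m" "L ! j = (\<nu> 1, \<nu> 2, \<nu> 3)"
      unfolding m_def in_set_conv_nth by blast
    have "args j fst = map (\<lambda>e. \<nu> (fst e)) ?es" "args j snd = map (\<lambda>e. \<nu> (snd e)) ?es"
      unfolding args_def val_def j(2) distinct_pairs3_def by simp_all
    moreover have "f (args j snd) = \<alpha> [f (args j fst)]"
      using arg_cong[OF \<alpha>(2), of "\<lambda>l. l ! j"] j(1) unfolding f(2,3) lift_def row_def by simp
    ultimately show ?thesis
      by simp
  qed
  then show ?thesis
    using f(1) \<alpha>(1) by blast
qed

end

section \<open>From finite sets to the whole domain\<close>

theorem theorem5p1:
  fixes C :: "'a set" and Cl :: "(nat \<times> ('a list \<Rightarrow> 'a)) set"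
  assumes "countable C"
    and "function_clone C Cl"
    and "closed_clone C Cl"
    and "oligomorphic C Cl"
    and "core_clone C Cl"
    and "locally_taylor C Cl"
  shows "satisfies_pL23 C Cl"
proof (cases "C = {}")
  \<comment> \<open>No assignment has its range in the empty set, so any functions of the clone will
    do.\<close>
  case True
  interpret oligomorphic_core C Cl
    using assms by unfold_locales
  show ?thesis
    using projection_in[of 0 6] projection_in[of 0 1] True
    unfolding satisfies_pL23_def satisfies_pseudo_loop_def distinct_pairs3_enumerates by auto
next
  case False
  interpret oligomorphic_core C Cl
    using assms by unfold_locales
  let ?es = distinct_pairs3
  \<comment> \<open>An increasing chain of finite sets exhausting \<open>C\<close>.\<close>
  define F where "F n = from_nat_into C ` {..n}" for n :: nat
  have F: "finite (F n)" "F n \<subseteq> C" for n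
    unfolding F_def using from_nat_into[OF False] by auto
  have F_mono: "F n \<subseteq> F k" if "n \<le> k" for n k
    unfolding F_def using that by auto
  have "\<forall>n. \<exists>f \<alpha>. (6, f) \<in> Cl \<and> \<alpha> \<in> \<G> \<and> (\<forall>\<nu>. \<nu> ` {1, 2, 3} \<subseteq> F n \<longrightarrow>
    \<alpha> [f (map (\<lambda>e. \<nu> (fst e)) ?es)] = f (map (\<lambda>e. \<nu> (snd e)) ?es))"
    using local_pseudo_loop[OF assms(6) F] by (intro allI)
  then obtain f \<alpha> where f: "\<And>n. (6, f n) \<in> Cl" and \<alpha>: "\<And>n. \<alpha> n \<in> \<G>"
    and loop: "\<And>n \<nu>. \<nu> ` {1, 2, 3} \<subseteq> F n \<Longrightarrow>
      \<alpha> n [f n (map (\<lambda>e. \<nu> (fst e)) ?es)] = f n (map (\<lambda>e. \<nu> (snd e)) ?es)"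
    by metis
  have fC: "\<forall>n. \<forall>t\<in>tuples C 6. f n t \<in> C"
    using operation_closed[OF f] by blast
  obtain H where H: "\<forall>t\<in>tuples C 6. H t \<in> C"
    and "\<forall>S N. finite S \<longrightarrow> S \<subseteq> tuples C 6 \<longrightarrow> (\<exists>n\<ge>N. \<exists>\<gamma>\<in>\<G>. \<forall>t\<in>S. \<gamma> [f n t] = H t)"
    using compactness[OF countable_tuples[OF assms(1)] fC]
    by (elim exE conjE)
  then have H_approx: "\<exists>n\<ge>N. \<exists>\<gamma>\<in>\<G>. \<forall>t\<in>S. \<gamma> [f n t] = H t"
    if "finite S" "S \<subseteq> tuples C 6" for S N
    using that by simp
  \<comment> \<open>On each finite set of arguments, \<open>H\<close> is some \<open>f n\<close>
    followed by a group element, so the limit stays in the closed clone.\<close>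
  define h where "h = (\<lambda>t\<in>tuples C 6. H t)"
  have h: "(6, h) \<in> Cl"
  proof (rule closed_approx)
    show "h \<in> operations C 6"
      unfolding h_def operations_def using H by simp
  next
    fix S
    assume S: "finite S" "S \<subseteq> tuples C 6"
    then obtain n \<gamma> where n: "\<gamma> \<in> \<G>" "\<forall>t\<in>S. \<gamma> [f n t] = H t"
      using H_approx[of S 0] by blast
    obtain g where "(6, g) \<in> Cl" "\<forall>t\<in>tuples C 6. g t = \<gamma> [f n t]"
      using compose_unary[OF Gr_in[OF n(1)] f] by blast
    then show "\<exists>g. (6, g) \<in> Cl \<and> (\<forall>t\<in>S. g t = h t)"
      using n(2) S(2) unfolding h_def by (intro exI[of _ g]) (simp add: subset_iff)
  qed simp
  have es_tuples: "map (\<lambda>e. \<nu> (fst e)) ?es \<in> tuples F 6" "map (\<lambda>e. \<nu> (snd e)) ?es \<in> tuples F 6"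
    if "\<nu> ` {1, 2, 3} \<subseteq> F" for \<nu> and F :: "'a set"
    using that unfolding tuples_def distinct_pairs3_def by auto
  have "\<exists>\<beta>\<in>\<G>. \<forall>\<nu>. \<nu> ` {1, 2, 3} \<subseteq> F N \<longrightarrow>
      \<beta> [h (map (\<lambda>e. \<nu> (fst e)) ?es)] = h (map (\<lambda>e. \<nu> (snd e)) ?es)" for N
  proof -
    have sub: "tuples (F N) 6 \<subseteq> tuples C 6"
      using F(2) unfolding tuples_def by blast
    obtain n \<gamma> where n: "n \<ge> N" "\<gamma> \<in> \<G>" "\<forall>t\<in>tuples (F N) 6. \<gamma> [f n t] = H t"
      using H_approx[OF finite_tuples[OF F(1)] sub] by blast
    \<comment> \<open>On tuples over \<open>F N\<close> the limit is \<open>f n\<close> followed by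
      \<open>\<gamma>\<close>, so \<open>\<alpha> n\<close> is replaced by its conjugate under
      \<open>\<gamma>\<close>.\<close>
    obtain \<delta> where \<delta>: "\<delta> \<in> \<G>" "\<forall>x\<in>C. \<delta> [\<gamma> [x]] = x"
      using Gr_inverse[OF n(2)] by blast
    obtain \<beta>\<^sub>0 where \<beta>\<^sub>0: "\<beta>\<^sub>0 \<in> \<G>" "\<forall>x\<in>C. \<beta>\<^sub>0 [x] = \<gamma> [\<alpha> n [x]]"
      using Gr_compose[OF n(2) \<alpha>] by blast
    obtain \<beta> where \<beta>: "\<beta> \<in> \<G>" "\<forall>x\<in>C. \<beta> [x] = \<beta>\<^sub>0 [\<delta> [x]]"
      using Gr_compose[OF \<beta>\<^sub>0(1) \<delta>(1)] by blast
    have "\<beta> [h (map (\<lambda>e. \<nu> (fst e)) ?es)] = h (map (\<lambda>e. \<nu> (snd e)) ?es)"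
      if \<nu>: "\<nu> ` {1, 2, 3} \<subseteq> F N" for \<nu>
    proof -
      let ?p = "map (\<lambda>e. \<nu> (fst e)) ?es" and ?q = "map (\<lambda>e. \<nu> (snd e)) ?es"
      have t: "?p \<in> tuples (F N) 6" "?q \<in> tuples (F N) 6"
        using es_tuples[OF \<nu>] .
      have tC: "?p \<in> tuples C 6" "?q \<in> tuples C 6"
        using t sub by blast+
      have hp: "h ?p = \<gamma> [f n ?p]" and hq: "h ?q = \<gamma> [f n ?q]"
        using t tC n(3) unfolding h_def by simp_all
      have fp: "f n ?p \<in> C"
        by (rule operation_closed[OF f tC(1)])
      have "\<beta> [h ?p] = \<gamma> [\<alpha> n [f n ?p]]"
        using fp \<beta>(2) \<beta>\<^sub>0(2) \<delta>(2) Gr_closed[OF n(2) fp] unfolding hp by simp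
      also have "\<alpha> n [f n ?p] = f n ?q"
        using loop \<nu> F_mono[OF n(1)] by blast
      finally show ?thesis
        unfolding hq .
    qed
    then show ?thesis
      using \<beta>(1) by blast
  qed
  then obtain \<beta> where \<beta>: "\<And>N. \<beta> N \<in> \<G>"
    and h_loop: "\<And>N \<nu>. \<nu> ` {1, 2, 3} \<subseteq> F N \<Longrightarrow>
      \<beta> N [h (map (\<lambda>e. \<nu> (fst e)) ?es)] = h (map (\<lambda>e. \<nu> (snd e)) ?es)"
    by metis
  \<comment> \<open>The limit of the pairs \<open>(\<beta> n, id)\<close> modulo the group yields both outer functions at once.\<close>
  define k where "k n t = (if fst t then \<beta> n [snd t] else snd t)" for n and t :: "bool \<times> 'a"
  have k: "\<forall>n. \<forall>t\<in>UNIV \<times> C. k n t \<in> C"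
    using Gr_closed[OF \<beta>] unfolding k_def by auto
  have cnt: "countable (UNIV \<times> C :: (bool \<times> 'a) set)"
    using assms(1) by simp
  obtain U where U: "\<forall>t\<in>UNIV \<times> C. U t \<in> C"
    and "\<forall>S N. finite S \<longrightarrow> S \<subseteq> UNIV \<times> C \<longrightarrow> (\<exists>n\<ge>N. \<exists>\<gamma>\<in>\<G>. \<forall>t\<in>S. \<gamma> [k n t] = U t)"
    using compactness[OF cnt k] by (elim exE conjE)
  then have U_approx: "\<exists>n\<ge>N. \<exists>\<gamma>\<in>\<G>. \<forall>t\<in>S. \<gamma> [k n t] = U t"
    if "finite S" "S \<subseteq> UNIV \<times> C" for S N
    using that by simp
  define u where "u b = (\<lambda>xs\<in>tuples C 1. U (b, hd xs))" for b
  have u: "(1, u b) \<in> Cl" for b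
    unfolding u_def
  proof (rule closed_unary_approx)
    show "U (b, x) \<in> C" if "x \<in> C" for x
      using U that by blast
  next
    fix S
    assume S: "finite S" "S \<subseteq> C"
    have fin: "finite (Pair b ` S)" and sub: "Pair b ` S \<subseteq> UNIV \<times> C"
      using S by auto
    obtain n \<gamma> where n: "\<gamma> \<in> \<G>" "\<forall>t\<in>Pair b ` S. \<gamma> [k n t] = U t"
      using U_approx[OF fin sub, of 0] by blast
    have "\<exists>g\<in>\<G>. \<forall>x\<in>C. g [x] = \<gamma> [k n (b, x)]"
      using Gr_compose[OF n(1) \<beta>] n(1) unfolding k_def by (cases b) auto
    then obtain g where "g \<in> \<G>" "\<forall>x\<in>C. g [x] = \<gamma> [k n (b, x)]"
      by blast
    then show "\<exists>g. (1, g) \<in> Cl \<and> (\<forall>x\<in>S. g [x] = U (b, x))"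
      using n(2) S(2) Gr_in by (intro exI[of _ g]) (simp add: subset_iff)
  qed
  have "u True [h (map (\<lambda>e. \<nu> (fst e)) ?es)] = u False [h (map (\<lambda>e. \<nu> (snd e)) ?es)]"
    if \<nu>: "range \<nu> \<subseteq> C" for \<nu>
  proof -
    let ?p = "h (map (\<lambda>e. \<nu> (fst e)) ?es)" and ?q = "h (map (\<lambda>e. \<nu> (snd e)) ?es)"
    have pq: "?p \<in> C" "?q \<in> C"
      using \<nu> by (auto intro!: operation_closed[OF h] es_tuples)
    \<comment> \<open>From stage \<open>N\<close> on, the chain contains all three values.\<close>
    define N where "N = Max (to_nat_on C ` \<nu> ` {1, 2, 3})"
    have "\<nu> v \<in> F N" if "v \<in> {1, 2, 3}" for v
    proof -
      have "to_nat_on C (\<nu> v) \<le> N"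
        unfolding N_def using that by (intro Max_ge) auto
      moreover have "\<nu> v = from_nat_into C (to_nat_on C (\<nu> v))"
        using assms(1) \<nu> by (simp add: image_subset_iff)
      ultimately show ?thesis
        unfolding F_def by blast
    qed
    then have \<nu>F: "\<nu> ` {1, 2, 3} \<subseteq> F N"
      by blast
    \<comment> \<open>Both points are approximated with the same \<open>\<gamma>\<close>, so the
      equation for \<open>\<beta> n\<close> passes to the limit.\<close>
    obtain n \<gamma> where n: "n \<ge> N" "\<gamma> [k n (True, ?p)] = U (True, ?p)" "\<gamma> [k n (False, ?q)] = U (False, ?q)"
      using U_approx[of "{(True, ?p), (False, ?q)}" N] pq by auto
    have "\<beta> n [?p] = ?q"
      using h_loop \<nu>F F_mono[OF n(1)] by blast
    then have "U (True, ?p) = U (False, ?q)"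
      using n(2,3) unfolding k_def by simp
    then show ?thesis
      using singleton_tuples[OF pq(1)] singleton_tuples[OF pq(2)] unfolding u_def by simp
  qed
  then show ?thesis
    unfolding satisfies_pL23_def satisfies_pseudo_loop_def distinct_pairs3_enumerates
    using h u by blast
qed

end
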